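(* Let $(F_0,\nu_0)$ be an isoparametric hypersurface in $\mathbb{S}^{n+1}$ with $g$ distinct principal curvatures. Then for all $X,Y,Z,W\in\Gamma(TM)$ \begin{align*} -4i\,g^2\,&T(X,Y,Z,W)=\\ \sum_{\ell,j=0}^{g-1}\mathrm{tr}_{\hat g}\Big(&\alpha(B_0^{-\ell}Y,B_0^{-j}W,\cdot)\sum_{k=0}^{j-1}\big(\alpha(B_0^{\ell}X,B_0^{k+1}Z,B_0^{j-k-1}\cdot)+\alpha(B_0^{\ell}X,B_0^{k}Z,B_0^{j-k}\cdot)\big)\\ &+\alpha(B_0^{-\ell}Y,B_0^{-j}Z,\cdot)\sum_{k=0}^{j-1}\big(\alpha(B_0^{\ell}X,B_0^{k+1}W,B_0^{j-k-1}\cdot)+\alpha(B_0^{\ell}X,B_0^{k}W,B_0^{j-k}\cdot)\big)\\ &-\alpha(B_0^{-j}W,B_0^{-\ell}Y,\cdot)\sum_{k=0}^{\ell-1}\big(\alpha(B_0^{j}Z,B_0^{k+1}X,B_0^{\ell-k-1}\cdot)+\alpha(B_0^{j}Z,B_0^{k}X,B_0^{\ell-k}\cdot)\big)\\ &-\alpha(B_0^{-j}W,B_0^{-\ell}X,\cdot)\sum_{k=0}^{\ell-1}\big(\alpha(B_0^{j}Z,B_0^{k+1}Y,B_0^{\ell-k-1}\cdot)+\alpha(B_0^{j}Z,B_0^{k}Y,B_0^{\ell-k}\cdot)\big)\Big). \end{align*}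
   Context: $M$ is a connected smooth $n$-manifold, $F_0:M\hookrightarrow\mathbb{S}^{n+1}\subset\mathbb{R}^{n+2}$ an embedding with unit normal field $\nu_0$ (tangent to the sphere) whose principal curvatures are constant (an isoparametric hypersurface). Shape operator: $d\nu_0=-dF_0A_0$; the $g$ distinct principal curvatures are $\lambda_1>\dots>\lambda_g$, $\lambda_j=\cot\theta_j$, with the standing normalization (choice of the hypersurface within its family of parallel hypersurfaces) $\theta_j=(2j-1)\frac{\pi}{2g}$ modulo $\pi$. $g_0$ is the metric induced by $F_0$ and $\nabla^0$ its Levi-Civita connection (the symbol $g$ without decoration is the number of principal curvatures). $\hat g(X,Y)=g_0(X,\frac12(\mathrm{Id}+A_0^2)Y)$ (a Riemannian metric on $M$, also extended complex bilinearly). $\alpha(X,Y,Z)=g_0((\nabla^0_XA_0)Y,Z)$, extended complex trilinearly to $TM\otimes\mathbb{C}$. $B_0=(A_0+i\,\mathrm{Id})(A_0-i\,\mathrm{Id})^{-1}$. $T(X,Y,Z,W)=\mathrm{Im}\big(\hat g(B_0X,Y)\,\hat g(B_0^{-1}Z,W)\big)$. $\mathrm{tr}_{\hat g}$ denotes the sum obtained by inserting the vectors of a $\hat g$-orthonormal basis into the two slots marked with a dot. *)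

theory Defs
  imports "HOL-Analysis.Analysis"
begin

section \<open>Smooth maps between Euclidean spaces\<close>

text \<open>Only used for open S.\<close>

fun Ck_on :: "nat \<Rightarrow> 'a::euclidean_space set \<Rightarrow> ('a \<Rightarrow> 'b::real_normed_vector) \<Rightarrow> bool" where
  "Ck_on 0 S f \<longleftrightarrow> continuous_on S f"
| "Ck_on (Suc k) S f \<longleftrightarrow>
     (\<forall>x\<in>S. f differentiable (at x)) \<and> (\<forall>v. Ck_on k S (\<lambda>x. frechet_derivative f (at x) v))"

definition smooth_on :: "'a::euclidean_space set \<Rightarrow> ('a \<Rightarrow> 'b::real_normed_vector) \<Rightarrow> bool" where
  "smooth_on S f \<longleftrightarrow> (\<forall>k. Ck_on k S f)"


section \<open>Smooth manifolds\<close>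

text \<open>A smooth n-manifold is a second countable Hausdorff topological space (the type 'p)
  with a smooth atlas of charts into \<open>real^'n\<close>, n = CARD('n). A chart (U, \<phi>) is a homeomorphism
  from the open set U onto an open set; the values of \<phi> off U are irrelevant.\<close>

type_synonym ('p, 'n) chart = "'p set \<times> ('p \<Rightarrow> real^'n)"

definition smooth_atlas ::
  "('p::{t2_space,second_countable_topology}, 'n::finite) chart set \<Rightarrow> bool" where
  "smooth_atlas \<A> \<longleftrightarrow>
     (\<Union>(U, \<phi>)\<in>\<A>. U) = UNIV \<and>
     (\<forall>(U, \<phi>)\<in>\<A>. open U \<and> open (\<phi> ` U) \<and> homeomorphism U (\<phi> ` U) \<phi> (inv_into U \<phi>)) \<and>
     (\<forall>(U, \<phi>)\<in>\<A>. \<forall>(V, \<psi>)\<in>\<A>. smooth_on (\<phi> ` (U \<inter> V)) (\<psi> \<circ> inv_into U \<phi>))"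

definition smooth_map ::
  "('p, 'n::finite) chart set \<Rightarrow> ('p \<Rightarrow> 'b::real_normed_vector) \<Rightarrow> bool" where
  "smooth_map \<A> f \<longleftrightarrow> (\<forall>(U, \<phi>)\<in>\<A>. smooth_on (\<phi> ` U) (f \<circ> inv_into U \<phi>))"

text \<open>The tangent space at p is \<open>real^'n\<close>, a tangent vector being given by its components in one
  chart around p, chosen once and for all. Vector fields are therefore functions
  \<open>'p \<Rightarrow> real^'n\<close>, but the components at different points refer to different charts.\<close>

definition chart_at :: "('p, 'n::finite) chart set \<Rightarrow> 'p \<Rightarrow> ('p, 'n) chart" where
  "chart_at \<A> p = (SOME c. c \<in> \<A> \<and> p \<in> fst c)"

text \<open>The differential of f at p applied to a tangent vector u, that is, df(u) or u f.\<close>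

definition mderiv ::
  "('p, 'n::finite) chart set \<Rightarrow> ('p \<Rightarrow> 'b::real_normed_vector) \<Rightarrow> 'p \<Rightarrow> real^'n \<Rightarrow> 'b" where
  "mderiv \<A> f p u =
     (case chart_at \<A> p of (U, \<phi>) \<Rightarrow> frechet_derivative (f \<circ> inv_into U \<phi>) (at (\<phi> p)) u)"

text \<open>The components of X in an arbitrary chart (U, \<phi>) at a point q are \<open>d\<phi>(X q)\<close>.\<close>

definition smooth_field :: "('p, 'n::finite) chart set \<Rightarrow> ('p \<Rightarrow> real^'n) \<Rightarrow> bool" where
  "smooth_field \<A> X \<longleftrightarrow>
     (\<forall>(U, \<phi>)\<in>\<A>. smooth_on (\<phi> ` U) ((\<lambda>q. mderiv \<A> \<phi> q (X q)) \<circ> inv_into U \<phi>))"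

text \<open>D is the Levi-Civita connection of the metric \<open>\<gamma>\<close>: an affine connection (clauses 1 to 5) which
  is torsion-free, \<open>D X Y - D Y X = [X, Y]\<close> with \<open>[X, Y] f = X (Y f) - Y (X f)\<close> for smooth f,
  and metric.\<close>

definition levi_civita ::
  "('p, 'n::finite) chart set \<Rightarrow> ('p \<Rightarrow> real^'n \<Rightarrow> real^'n \<Rightarrow> real) \<Rightarrow>
   (('p \<Rightarrow> real^'n) \<Rightarrow> ('p \<Rightarrow> real^'n) \<Rightarrow> ('p \<Rightarrow> real^'n)) \<Rightarrow> bool" where
  "levi_civita \<A> \<gamma> D \<longleftrightarrow>
    (\<forall>X Y. smooth_field \<A> X \<longrightarrow> smooth_field \<A> Y \<longrightarrow> smooth_field \<A> (D X Y)) \<and>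
    (\<forall>X Y Z. smooth_field \<A> X \<longrightarrow> smooth_field \<A> Y \<longrightarrow> smooth_field \<A> Z \<longrightarrow>
       (\<forall>p. D (\<lambda>q. X q + Y q) Z p = D X Z p + D Y Z p)) \<and>
    (\<forall>f X Y. smooth_map \<A> (f :: 'p \<Rightarrow> real) \<longrightarrow> smooth_field \<A> X \<longrightarrow> smooth_field \<A> Y \<longrightarrow>
       (\<forall>p. D (\<lambda>q. f q *\<^sub>R X q) Y p = f p *\<^sub>R D X Y p)) \<and>
    (\<forall>X Y Z. smooth_field \<A> X \<longrightarrow> smooth_field \<A> Y \<longrightarrow> smooth_field \<A> Z \<longrightarrow>
       (\<forall>p. D X (\<lambda>q. Y q + Z q) p = D X Y p + D X Z p)) \<and>
    (\<forall>f X Y. smooth_map \<A> (f :: 'p \<Rightarrow> real) \<longrightarrow> smooth_field \<A> X \<longrightarrow> smooth_field \<A> Y \<longrightarrow>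
       (\<forall>p. D X (\<lambda>q. f q *\<^sub>R Y q) p = mderiv \<A> f p (X p) *\<^sub>R Y p + f p *\<^sub>R D X Y p)) \<and>
    (\<forall>f X Y. smooth_map \<A> (f :: 'p \<Rightarrow> real) \<longrightarrow> smooth_field \<A> X \<longrightarrow> smooth_field \<A> Y \<longrightarrow>
       (\<forall>p. mderiv \<A> f p (D X Y p - D Y X p) =
            mderiv \<A> (\<lambda>q. mderiv \<A> f q (Y q)) p (X p) - mderiv \<A> (\<lambda>q. mderiv \<A> f q (X q)) p (Y p))) \<and>
    (\<forall>X Y Z. smooth_field \<A> X \<longrightarrow> smooth_field \<A> Y \<longrightarrow> smooth_field \<A> Z \<longrightarrow>
       (\<forall>p. mderiv \<A> (\<lambda>q. \<gamma> q (Y q) (Z q)) p (X p) =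
            \<gamma> p (D X Y p) (Z p) + \<gamma> p (Y p) (D X Z p)))"


section \<open>Complex multilinear extensions\<close>

text \<open>The complexified tangent space is \<open>complex^'n\<close>. Each definition below yields the unique
  complex (multi)linear extension of a real (multi)linear argument.\<close>

definition cvec :: "real^'n \<Rightarrow> complex^'n" where
  "cvec u = (\<chi> i. of_real (u $ i))"

definition clinear_ext :: "(real^'n \<Rightarrow> real^'n) \<Rightarrow> complex^'n \<Rightarrow> complex^'n::finite" where
  "clinear_ext L x = (\<Sum>a\<in>UNIV. x $ a *s cvec (L (axis a 1)))"

definition cbilinear_ext ::
  "(real^'n \<Rightarrow> real^'n \<Rightarrow> real) \<Rightarrow> complex^'n \<Rightarrow> complex^'n::finite \<Rightarrow> complex" where
  "cbilinear_ext b x y =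
     (\<Sum>a\<in>UNIV. \<Sum>c\<in>UNIV. x $ a * y $ c * of_real (b (axis a 1) (axis c 1)))"

definition ctrilinear_ext ::
  "(real^'n \<Rightarrow> real^'n \<Rightarrow> real^'n \<Rightarrow> real) \<Rightarrow>
   complex^'n \<Rightarrow> complex^'n \<Rightarrow> complex^'n::finite \<Rightarrow> complex" where
  "ctrilinear_ext t x y z =
     (\<Sum>a\<in>UNIV. \<Sum>b\<in>UNIV. \<Sum>c\<in>UNIV.
        x $ a * y $ b * z $ c * of_real (t (axis a 1) (axis b 1) (axis c 1)))"


section \<open>Hypersurfaces of the sphere\<close>

definition induced_metric ::
  "('p, 'n::finite) chart set \<Rightarrow> ('p \<Rightarrow> real^'m) \<Rightarrow> 'p \<Rightarrow> real^'n \<Rightarrow> real^'n \<Rightarrow> real" where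
  "induced_metric \<A> F p u v = mderiv \<A> F p u \<bullet> mderiv \<A> F p v"

definition smooth_embedding ::
  "('p::topological_space, 'n::finite) chart set \<Rightarrow> ('p \<Rightarrow> 'b::real_normed_vector) \<Rightarrow> bool" where
  "smooth_embedding \<A> F \<longleftrightarrow>
     smooth_map \<A> F \<and> (\<forall>p. inj (mderiv \<A> F p)) \<and> embedding_map euclidean euclidean F"

text \<open>F embeds the manifold into the unit sphere and \<nu> is a unit normal field, tangent to the
  sphere.\<close>

definition sphere_hypersurface ::
  "('p::topological_space, 'n::finite) chart set \<Rightarrow> ('p \<Rightarrow> real^'m) \<Rightarrow> ('p \<Rightarrow> real^'m) \<Rightarrow> bool" where
  "sphere_hypersurface \<A> F \<nu> \<longleftrightarrow>
     CARD('m) = CARD('n) + 2 \<and>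
     smooth_embedding \<A> F \<and> (\<forall>p. F p \<in> sphere 0 1) \<and>
     smooth_map \<A> \<nu> \<and>
     (\<forall>p. norm (\<nu> p) = 1 \<and> \<nu> p \<bullet> F p = 0 \<and> (\<forall>u. \<nu> p \<bullet> mderiv \<A> F p u = 0))"

definition shape_operator ::
  "('p, 'n::finite) chart set \<Rightarrow> ('p \<Rightarrow> real^'m) \<Rightarrow> ('p \<Rightarrow> real^'m) \<Rightarrow> 'p \<Rightarrow> real^'n \<Rightarrow> real^'n" where
  "shape_operator \<A> F \<nu> p u = (THE w. mderiv \<A> \<nu> p u = - mderiv \<A> F p w)"

text \<open>The set of distinct principal curvatures is at every point
  \<open>\<kappa> 1 > \<dots> > \<kappa> g\<close>, with \<kappa> independent of the point.\<close>

definition isoparametric ::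
  "('p::topological_space, 'n::finite) chart set \<Rightarrow> ('p \<Rightarrow> real^'m) \<Rightarrow> ('p \<Rightarrow> real^'m) \<Rightarrow>
   nat \<Rightarrow> (nat \<Rightarrow> real) \<Rightarrow> bool" where
  "isoparametric \<A> F \<nu> g \<kappa> \<longleftrightarrow>
     sphere_hypersurface \<A> F \<nu> \<and>
     (\<forall>i\<in>{1..g}. \<forall>j\<in>{1..g}. i < j \<longrightarrow> \<kappa> i > \<kappa> j) \<and>
     (\<forall>p. {c. \<exists>u. u \<noteq> 0 \<and> shape_operator \<A> F \<nu> p u = c *\<^sub>R u} = \<kappa> ` {1..g})"

text \<open>\<open>cov_deriv_shape \<A> F \<nu> D p u v\<close> is the vector \<open>(D_u A) v\<close> at p, that is, the common value of
  \<open>D_U (A V) - A (D_U V)\<close> at p over all smooth extensions U, V of the tangent vectors u, v.\<close>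

definition cov_deriv_shape ::
  "('p, 'n::finite) chart set \<Rightarrow> ('p \<Rightarrow> real^'m) \<Rightarrow> ('p \<Rightarrow> real^'m) \<Rightarrow>
   (('p \<Rightarrow> real^'n) \<Rightarrow> ('p \<Rightarrow> real^'n) \<Rightarrow> ('p \<Rightarrow> real^'n)) \<Rightarrow>
   'p \<Rightarrow> real^'n \<Rightarrow> real^'n \<Rightarrow> real^'n" where
  "cov_deriv_shape \<A> F \<nu> D p u v =
     (THE t. \<forall>U V. smooth_field \<A> U \<longrightarrow> smooth_field \<A> V \<longrightarrow> U p = u \<longrightarrow> V p = v \<longrightarrow>
        D U (\<lambda>q. shape_operator \<A> F \<nu> q (V q)) p - shape_operator \<A> F \<nu> p (D U V p) = t)"

definition alpha ::
  "('p, 'n::finite) chart set \<Rightarrow> ('p \<Rightarrow> real^'m) \<Rightarrow> ('p \<Rightarrow> real^'m) \<Rightarrow>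
   (('p \<Rightarrow> real^'n) \<Rightarrow> ('p \<Rightarrow> real^'n) \<Rightarrow> ('p \<Rightarrow> real^'n)) \<Rightarrow>
   'p \<Rightarrow> complex^'n \<Rightarrow> complex^'n \<Rightarrow> complex^'n \<Rightarrow> complex" where
  "alpha \<A> F \<nu> D p =
     ctrilinear_ext (\<lambda>u v w. induced_metric \<A> F p (cov_deriv_shape \<A> F \<nu> D p u v) w)"

definition ghat ::
  "('p, 'n::finite) chart set \<Rightarrow> ('p \<Rightarrow> real^'m) \<Rightarrow> ('p \<Rightarrow> real^'m) \<Rightarrow>
   'p \<Rightarrow> real^'n \<Rightarrow> real^'n \<Rightarrow> real" where
  "ghat \<A> F \<nu> p u v =
     induced_metric \<A> F p u
       ((1/2) *\<^sub>R (v + shape_operator \<A> F \<nu> p (shape_operator \<A> F \<nu> p v)))"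

definition B0 ::
  "('p, 'n::finite) chart set \<Rightarrow> ('p \<Rightarrow> real^'m) \<Rightarrow> ('p \<Rightarrow> real^'m) \<Rightarrow>
   'p \<Rightarrow> complex^'n \<Rightarrow> complex^'n" where
  "B0 \<A> F \<nu> p =
     (\<lambda>x. clinear_ext (shape_operator \<A> F \<nu> p) x + \<i> *s x) \<circ>
     inv (\<lambda>x. clinear_ext (shape_operator \<A> F \<nu> p) x - \<i> *s x)"

definition B0_power ::
  "('p, 'n::finite) chart set \<Rightarrow> ('p \<Rightarrow> real^'m) \<Rightarrow> ('p \<Rightarrow> real^'m) \<Rightarrow>
   'p \<Rightarrow> int \<Rightarrow> complex^'n \<Rightarrow> complex^'n" where
  "B0_power \<A> F \<nu> p k =
     (if k \<ge> 0 then B0 \<A> F \<nu> p ^^ nat k else inv (B0 \<A> F \<nu> p) ^^ nat (- k))"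

definition T_tensor ::
  "('p, 'n::finite) chart set \<Rightarrow> ('p \<Rightarrow> real^'m) \<Rightarrow> ('p \<Rightarrow> real^'m) \<Rightarrow>
   'p \<Rightarrow> real^'n \<Rightarrow> real^'n \<Rightarrow> real^'n \<Rightarrow> real^'n \<Rightarrow> real" where
  "T_tensor \<A> F \<nu> p x y z w =
     Im (cbilinear_ext (ghat \<A> F \<nu> p) (B0_power \<A> F \<nu> p 1 (cvec x)) (cvec y) *
         cbilinear_ext (ghat \<A> F \<nu> p) (B0_power \<A> F \<nu> p (- 1) (cvec z)) (cvec w))"

definition orthonormal_frame :: "(real^'n \<Rightarrow> real^'n \<Rightarrow> real) \<Rightarrow> ('n::finite \<Rightarrow> real^'n) \<Rightarrow> bool" where
  "orthonormal_frame b e \<longleftrightarrow> (\<forall>i j. b (e i) (e j) = (if i = j then 1 else 0))"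

definition frame_trace :: "('n::finite \<Rightarrow> real^'n) \<Rightarrow> (complex^'n \<Rightarrow> complex^'n \<Rightarrow> complex) \<Rightarrow> complex" where
  "frame_trace e Q = (\<Sum>i\<in>UNIV. Q (cvec (e i)) (cvec (e i)))"

end

theory Submission
  imports Defs
begin

text \<open>The embedding makes every construction global: a field \<open>X\<close> is smooth iff \<open>dF X\<close> is a smooth map,
  tangential projections of constant vectors give smooth fields through any tangent vector, and,
  the principal curvatures being constant, polynomials in the shape operator turn these into
  eigenfields. Comparing \<open>D\<close> with the derivative of the ambient space gives the Gauss formula, the
  Gauss equation and the Codazzi equation. For eigenfields of distinct curvatures \<open>a\<close>, \<open>c\<close> the Gauss
  equation becomes a polarised Cartan identity
  \<open>(1 + a c) \<langle>x, y\<rangle> \<langle>z, w\<rangle> = \<Sum>\<^sub>m (\<langle>\<alpha>(y, w), \<alpha>(x, z)\<rangle>\<^sub>m + \<langle>\<alpha>(y, z), \<alpha>(x, w)\<rangle>\<^sub>m) / ((m - a) (m - c))\<close>,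
  the sum running over the other curvatures. On the eigenspace of \<open>a\<close> the operator \<open>B\<^sub>0\<close> is
  multiplication by \<open>(a + \<i>) / (a - \<i>)\<close>, a \<open>g\<close>-th root of \<open>- 1\<close>. The sums over \<open>l\<close> and \<open>j\<close> are
  therefore orthogonality relations between roots of unity, and on eigenvectors the claim reduces
  to Cartan's identity.\<close>


section \<open>Smooth maps between Euclidean spaces\<close>

text \<open>The coefficients fit together as follows. On eigenvectors the sum over \<open>k\<close>
  is a finite geometric sum with factor \<open>(cayley c + cayley m) / (cayley c - cayley m) = -
  \<i> (1 + c m) / (m - c)\<close>, and the trace for the metric \<open>(1/2) (Id + A^2)\<close>
  weights the eigenspace of \<open>m\<close> by \<open>2 / (1 + m^2)\<close>. Neither resembles
  Cartan's weight \<open>1 / ((m - a) (m - c))\<close>. That weight appears only when the last two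
  terms of the theorem are subtracted from the first two, because
  \<open>(1 + c m) (m - a) - (1 + a m) (m - c) = (c - a) (1 + m^2)\<close>, and here
  \<open>1 + m^2\<close> cancels against the trace. Vanishing denominators are harmless: \<alpha> is
  zero as soon as two of its arguments lie in one eigenspace, which is where constancy of the
  curvatures enters. A tangent vector is a tuple of components in a chart that changes from point to
  point, so a field is not itself a smooth function; this is why everything is transported to the
  ambient space by \<open>dF\<close>.\<close>

lemma frechet_derivative_cong_open:
  assumes "open S" "x \<in> S" "\<And>y. y \<in> S \<Longrightarrow> f y = g y"
  shows "frechet_derivative f (at x) = frechet_derivative g (at x)"
proof -
  have "(f has_derivative D) (at x) = (g has_derivative D) (at x)" for D
    using assms has_derivative_transform_within_open[of f D x UNIV S g]
      has_derivative_transform_within_open[of g D x UNIV S f] by auto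
  \<comment> \<open>\<open>frechet_derivative\<close> is a choice from the set of derivatives; the
    two sets agree, hence so do the choices.\<close>
  then show ?thesis by (simp add: frechet_derivative_def)
qed

lemma differentiable_cong_open:
  assumes "open S" "x \<in> S" "\<And>y. y \<in> S \<Longrightarrow> f y = g y" "f differentiable at x"
  shows "g differentiable at x"
  using assms has_derivative_transform_within_open[of f _ x UNIV S g]
  unfolding differentiable_def by blast

text \<open>The differentiation rules determine a derivative only at points of \<open>S\<close>,
  while \<open>Ck_on\<close> recurses on a total function; each closure proof below passes through
  this bridge.\<close>

lemma Ck_on_cong:
  assumes "open S" "\<And>x. x \<in> S \<Longrightarrow> f x = g x" "Ck_on k S f"
  shows "Ck_on k S g"
  using assms(2,3)
proof (induction k arbitrary: f g)
  case 0
  then show ?case using continuous_on_cong[of S S f g] by simp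
next
  case (Suc k)
  have "g differentiable at x" if "x \<in> S" for x
    using differentiable_cong_open[OF assms(1) that Suc.prems(1)] Suc.prems(2) that by auto
  moreover have "Ck_on k S (\<lambda>x. frechet_derivative g (at x) v)" for v
    by (rule Suc.IH[of "\<lambda>x. frechet_derivative f (at x) v"])
      (use Suc.prems frechet_derivative_cong_open[OF assms(1) _ Suc.prems(1)] in auto)
  ultimately show ?case by simp
qed

lemma Ck_on_Suc_lower: "Ck_on (Suc k) S f \<Longrightarrow> Ck_on k S f"
proof (induction k arbitrary: f)
  case 0
  then show ?case
    by (auto intro!: differentiable_imp_continuous_on differentiable_at_imp_differentiable_on)
qed auto

lemma Ck_on_const: "Ck_on k S (\<lambda>x. c)"
  by (induction k arbitrary: c) (auto simp: frechet_derivative_const)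

lemma Ck_on_add:
  assumes "open S" "Ck_on k S f" "Ck_on k S g"
  shows "Ck_on k S (\<lambda>x. f x + g x)"
  using assms(2,3)
proof (induction k arbitrary: f g)
  case (Suc k)
  have der: "((\<lambda>x. f x + g x) has_derivative (\<lambda>v. frechet_derivative f (at x) v +
      frechet_derivative g (at x) v)) (at x)" if "x \<in> S" for x
    using Suc.prems that by (intro has_derivative_add) (auto simp: frechet_derivative_works)
  have "Ck_on k S (\<lambda>x. frechet_derivative (\<lambda>x. f x + g x) (at x) v)" for v
    by (rule Ck_on_cong[OF assms(1) _ Suc.IH[of "\<lambda>x. frechet_derivative f (at x) v"
            "\<lambda>x. frechet_derivative g (at x) v"]])
      (use Suc.prems frechet_derivative_at[OF der] in \<open>auto simp: fun_eq_iff\<close>)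
  then show ?case using Suc.prems by auto
qed (auto intro: continuous_intros)

lemma Ck_on_bounded_linear:
  assumes "open S" "bounded_linear h" "Ck_on k S f"
  shows "Ck_on k S (\<lambda>x. h (f x))"
  using assms(3)
proof (induction k arbitrary: f)
  case 0
  then show ?case using bounded_linear.continuous_on[OF assms(2)] by auto
next
  case (Suc k)
  have der: "((\<lambda>x. h (f x)) has_derivative (\<lambda>v. h (frechet_derivative f (at x) v))) (at x)"
    if "x \<in> S" for x
    using bounded_linear.has_derivative[OF assms(2)] Suc.prems that
    by (auto simp: frechet_derivative_works)
  have "Ck_on k S (\<lambda>x. frechet_derivative (\<lambda>x. h (f x)) (at x) v)" for v
    by (rule Ck_on_cong[OF assms(1) _ Suc.IH[of "\<lambda>x. frechet_derivative f (at x) v"]])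
      (use Suc.prems frechet_derivative_at[OF der] in \<open>auto simp: fun_eq_iff\<close>)
  then show ?case using der by (auto simp: differentiable_def)
qed

lemma Ck_on_bounded_bilinear:
  assumes "open S" "bounded_bilinear h" "Ck_on k S f" "Ck_on k S g"
  shows "Ck_on k S (\<lambda>x. h (f x) (g x))"
  using assms(3,4)
proof (induction k arbitrary: f g)
  case 0
  then show ?case using bounded_bilinear.continuous_on[OF assms(2)] by auto
next
  case (Suc k)
  have der: "((\<lambda>x. h (f x) (g x)) has_derivative (\<lambda>v. h (f x) (frechet_derivative g (at x) v) +
      h (frechet_derivative f (at x) v) (g x))) (at x)" if "x \<in> S" for x
    using Suc.prems that
    by (intro bounded_bilinear.FDERIV[OF assms(2)]) (auto simp: frechet_derivative_works)
  have "Ck_on k S (\<lambda>x. frechet_derivative (\<lambda>x. h (f x) (g x)) (at x) v)" for v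
  proof (rule Ck_on_cong[OF assms(1) _ Ck_on_add[OF assms(1) Suc.IH Suc.IH]])
    fix x assume "x \<in> S"
    then show "h (f x) (frechet_derivative g (at x) v) + h (frechet_derivative f (at x) v) (g x) =
        frechet_derivative (\<lambda>x. h (f x) (g x)) (at x) v"
      using frechet_derivative_at[OF der] by (auto simp: fun_eq_iff)
  next
    \<comment> \<open>The product rule keeps one factor undifferentiated, so that factor must be
      lowered from order \<open>Suc k\<close> to \<open>k\<close>.\<close>
    show "Ck_on k S f" "Ck_on k S g" using Suc.prems Ck_on_Suc_lower by blast+
  qed (use Suc.prems in auto)
  then show ?case using der by (auto simp: differentiable_def)
qed

text \<open>The derivative of \<open>1 / f\<close> is a product of \<open>1 / f\<close> with itself
  and the derivative of \<open>f\<close>, so order \<open>k\<close> of \<open>1 / f\<close> yields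
  order \<open>Suc k\<close>.\<close>

lemma Ck_on_inverse:
  fixes f :: "'a::euclidean_space \<Rightarrow> real"
  assumes "open S" "Ck_on k S f" "\<And>x. x \<in> S \<Longrightarrow> f x \<noteq> 0"
  shows "Ck_on k S (\<lambda>x. inverse (f x))"
  using assms(2)
proof (induction k)
  case 0
  then show ?case using assms(3) by (auto intro: continuous_intros)
next
  case (Suc k)
  have der: "((\<lambda>x. inverse (f x)) has_derivative (\<lambda>v. - (inverse (f x) *
      frechet_derivative f (at x) v * inverse (f x)))) (at x)" if "x \<in> S" for x
    using has_derivative_inverse'[of "f x"] assms(3) Suc.prems that
      has_derivative_compose[of f "frechet_derivative f (at x)" x UNIV inverse]
    by (auto simp: frechet_derivative_works)
  have k: "Ck_on k S (\<lambda>x. inverse (f x))"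
    using Suc Ck_on_Suc_lower by blast
  have "Ck_on k S (\<lambda>x. frechet_derivative (\<lambda>x. inverse (f x)) (at x) v)" for v
  proof (rule Ck_on_cong[OF assms(1)])
    show "Ck_on k S (\<lambda>x. - (inverse (f x) * frechet_derivative f (at x) v * inverse (f x)))"
      using Suc.prems
      by (intro Ck_on_bounded_linear[OF assms(1), where h = uminus]
          Ck_on_bounded_bilinear[OF assms(1) bounded_bilinear_mult]
          bounded_linear_minus bounded_linear_ident k) auto
    fix x assume "x \<in> S"
    then show "- (inverse (f x) * frechet_derivative f (at x) v * inverse (f x)) =
        frechet_derivative (\<lambda>x. inverse (f x)) (at x) v"
      using frechet_derivative_at[OF der] by (auto simp: fun_eq_iff)
  qed
  then show ?case using der by (auto simp: differentiable_def)
qed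

lemma smooth_on_cong:
  "open S \<Longrightarrow> (\<And>x. x \<in> S \<Longrightarrow> f x = g x) \<Longrightarrow> smooth_on S f \<Longrightarrow> smooth_on S g"
  unfolding smooth_on_def using Ck_on_cong by blast

lemma smooth_on_const: "smooth_on S (\<lambda>x. c)"
  by (simp add: smooth_on_def Ck_on_const)

lemma smooth_on_add:
  "open S \<Longrightarrow> smooth_on S f \<Longrightarrow> smooth_on S g \<Longrightarrow> smooth_on S (\<lambda>x. f x + g x)"
  by (simp add: smooth_on_def Ck_on_add)

lemma smooth_on_bounded_linear:
  "open S \<Longrightarrow> bounded_linear h \<Longrightarrow> smooth_on S f \<Longrightarrow> smooth_on S (\<lambda>x. h (f x))"
  by (simp add: smooth_on_def Ck_on_bounded_linear)

lemma smooth_on_bounded_bilinear: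
  "open S \<Longrightarrow> bounded_bilinear h \<Longrightarrow> smooth_on S f \<Longrightarrow> smooth_on S g \<Longrightarrow>
    smooth_on S (\<lambda>x. h (f x) (g x))"
  by (simp add: smooth_on_def Ck_on_bounded_bilinear)

lemma smooth_on_inverse:
  fixes f :: "'a::euclidean_space \<Rightarrow> real"
  shows "open S \<Longrightarrow> smooth_on S f \<Longrightarrow> (\<And>x. x \<in> S \<Longrightarrow> f x \<noteq> 0) \<Longrightarrow> smooth_on S (\<lambda>x. inverse (f x))"
  by (simp add: smooth_on_def Ck_on_inverse)

lemma smooth_on_sum:
  "open S \<Longrightarrow> (\<And>i. i \<in> I \<Longrightarrow> smooth_on S (f i)) \<Longrightarrow> smooth_on S (\<lambda>x. \<Sum>i\<in>I. f i x)"
  by (induction I rule: infinite_finite_induct) (simp_all add: smooth_on_const smooth_on_add)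

lemma smooth_on_prod:
  fixes f :: "'i \<Rightarrow> 'a::euclidean_space \<Rightarrow> real"
  shows "open S \<Longrightarrow> (\<And>i. i \<in> I \<Longrightarrow> smooth_on S (f i)) \<Longrightarrow> smooth_on S (\<lambda>x. \<Prod>i\<in>I. f i x)"
proof (induction I rule: infinite_finite_induct)
  case (insert i I)
  then have "smooth_on S (f i)" "smooth_on S (\<lambda>x. \<Prod>i\<in>I. f i x)" by auto
  from smooth_on_bounded_bilinear[OF insert.prems(1) bounded_bilinear_mult this]
  show ?case using insert.hyps by simp
qed (simp_all add: smooth_on_const)

lemma smooth_on_vecI:
  fixes f :: "'a::euclidean_space \<Rightarrow> real^'m"
  assumes "open S" "\<And>i. smooth_on S (\<lambda>x. f x $ i)"
  shows "smooth_on S f"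
proof -
  have "f = (\<lambda>x. \<Sum>i\<in>UNIV. (f x $ i) *\<^sub>R axis i 1)"
    by (rule ext) (simp add: vec_eq_iff axis_def if_distrib cong: if_cong)
  moreover have "smooth_on S (\<lambda>x. \<Sum>i\<in>UNIV. (f x $ i) *\<^sub>R axis i 1 :: real^'m)"
    using assms by (intro smooth_on_sum smooth_on_bounded_linear[OF _ bounded_linear_scaleR_left]) auto
  ultimately show ?thesis by metis
qed

lemma smooth_on_det:
  fixes M :: "'a::euclidean_space \<Rightarrow> real^'n^'n"
  assumes "open S" "\<And>i j. smooth_on S (\<lambda>x. M x $ i $ j)"
  shows "smooth_on S (\<lambda>x. det (M x))"
proof -
  have "smooth_on S (\<lambda>x. \<Prod>i\<in>UNIV. M x $ i $ q i)" for q :: "'n \<Rightarrow> 'n"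
    using assms by (rule smooth_on_prod)
  from smooth_on_bounded_bilinear[OF assms(1) bounded_bilinear_mult smooth_on_const this]
  show ?thesis unfolding det_def by (intro smooth_on_sum assms(1))
qed

lemma smooth_on_differentiable: "smooth_on S f \<Longrightarrow> x \<in> S \<Longrightarrow> f differentiable at x"
  unfolding smooth_on_def by (auto dest: spec[of _ "Suc 0"])

text \<open>\<open>Ck_on\<close> differentiates in constant directions only; a variable direction is
  expanded in the standard basis.\<close>

lemma smooth_on_frechet:
  assumes "open S" "smooth_on S f" "smooth_on S V"
  shows "smooth_on S (\<lambda>x. frechet_derivative f (at x) (V x))"
proof -
  have *: "smooth_on S (\<lambda>x. frechet_derivative f (at x) v)" for v
  proof -
    have "Ck_on (Suc k) S f" for k using assms(2) by (simp add: smooth_on_def)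
    then show ?thesis by (simp add: smooth_on_def)
  qed
  have eq: "(\<Sum>b\<in>Basis. (V x \<bullet> b) *\<^sub>R frechet_derivative f (at x) b) = frechet_derivative f (at x) (V x)"
    if "x \<in> S" for x
  proof -
    interpret linear "frechet_derivative f (at x)"
      using smooth_on_differentiable[OF assms(2) that] by (rule linear_frechet_derivative)
    show ?thesis
      by (subst (3) euclidean_representation[symmetric]) (simp add: sum scaleR)
  qed
  have "smooth_on S (\<lambda>x. \<Sum>b\<in>Basis. (V x \<bullet> b) *\<^sub>R frechet_derivative f (at x) b)"
    using assms(1,3) *
    by (intro smooth_on_sum smooth_on_bounded_bilinear[OF _ bounded_bilinear_scaleR]
        smooth_on_bounded_linear[OF _ bounded_linear_inner_left]) auto
  from smooth_on_cong[OF assms(1) eq this] show ?thesis .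
qed

text \<open>Normal equations: the solution of \<open>J x = V\<close> is that of \<open>J\<^sup>t J x = J\<^sup>t V\<close>, to which
  Cramer's rule applies.\<close>

lemma smooth_on_solve:
  fixes J :: "'a::euclidean_space \<Rightarrow> real^'n \<Rightarrow> real^'m" and V W
  assumes "open S" and lin: "\<And>x. x \<in> S \<Longrightarrow> linear (J x)" and inj: "\<And>x. x \<in> S \<Longrightarrow> inj (J x)"
    and sJ: "\<And>v. smooth_on S (\<lambda>x. J x v)" and "smooth_on S V"
    and eq: "\<And>x. x \<in> S \<Longrightarrow> J x (W x) = V x"
  shows "smooth_on S W"
proof (rule smooth_on_vecI[OF assms(1)])
  fix k
  define G :: "'a \<Rightarrow> real^'n^'n" where "G x = (\<chi> i j. J x (axis i 1) \<bullet> J x (axis j 1))" for x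
  define b :: "'a \<Rightarrow> real^'n" where "b x = (\<chi> i. J x (axis i 1) \<bullet> V x)" for x
  have sG: "smooth_on S (\<lambda>x. G x $ i $ j)" and sb: "smooth_on S (\<lambda>x. b x $ i)" for i j
    using assms by (auto simp: G_def b_def intro!: smooth_on_bounded_bilinear[OF _ bounded_bilinear_inner])
  have Gv: "(G x *v u) $ i = J x (axis i 1) \<bullet> J x u" if "x \<in> S" for x u i
  proof -
    interpret linear "J x" using lin that .
    have "J x u = (\<Sum>j\<in>UNIV. u $ j *\<^sub>R J x (axis j 1))"
      by (subst basis_expansion[of u, symmetric])
         (simp only: sum scaleR scalar_mult_eq_scaleR)
    then show ?thesis
      by (simp add: G_def matrix_vector_mult_def inner_sum_right mult.commute)
  qed
  have det: "det (G x) \<noteq> 0" if x: "x \<in> S" for x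
  proof -
    interpret linear "J x" using lin x .
    \<comment> \<open>For \<open>u\<close> in the kernel of the Gram matrix, \<open>J x u\<close> is
      orthogonal to all columns of \<open>J x\<close>, hence to itself.\<close>
    have "u = 0" if "G x *v u = 0" for u
    proof -
      have "J x (axis i 1) \<bullet> J x u = 0" for i using Gv[OF x, of u i] that by simp
      moreover have "J x u = (\<Sum>j\<in>UNIV. u $ j *\<^sub>R J x (axis j 1))"
        by (subst basis_expansion[of u, symmetric])
          (simp only: sum scaleR scalar_mult_eq_scaleR)
      ultimately have "J x u \<bullet> J x u = (\<Sum>j\<in>UNIV. u $ j * 0)"
        by (subst (1) \<open>J x u = _\<close>) (simp only: inner_sum_left inner_scaleR_left)
      then have "J x u = 0" by simp
      then show "u = 0" using inj[OF x] zero by (metis injD)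
    qed
    then show ?thesis
      using invertible_det_nz matrix_left_invertible_ker invertible_left_inverse by blast
  qed
  have "W x $ k = det (\<chi> i j. if j = k then b x $ i else G x $ i $ j) * inverse (det (G x))"
    if x: "x \<in> S" for x
  proof -
    have "G x *v W x = b x" by (rule vec_eq_iff[THEN iffD2]) (simp add: Gv[OF x] eq[OF x] b_def)
    then have "W x = (\<chi> k. det (\<chi> i j. if j = k then b x $ i else G x $ i $ j) / det (G x))"
      using cramer[OF det[OF x]] by blast
    then show ?thesis by (simp only: divide_inverse vec_lambda_beta)
  qed
  moreover have "smooth_on S (\<lambda>x. det (\<chi> i j. if j = k then b x $ i else G x $ i $ j) * inverse (det (G x)))"
  proof (rule smooth_on_bounded_bilinear[OF assms(1) bounded_bilinear_mult])
    show "smooth_on S (\<lambda>x. det (\<chi> i j. if j = k then b x $ i else G x $ i $ j))"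
    proof (rule smooth_on_det[OF assms(1)])
      show "smooth_on S (\<lambda>x. (\<chi> i j. if j = k then b x $ i else G x $ i $ j) $ i $ j)" for i j
        using sG sb by (cases "j = k") simp_all
    qed
    show "smooth_on S (\<lambda>x. inverse (det (G x)))"
      by (intro smooth_on_inverse smooth_on_det assms(1) sG det)
  qed
  ultimately show "smooth_on S (\<lambda>x. W x $ k)" by (rule smooth_on_cong[OF assms(1) sym])
qed


section \<open>Calculus on a manifold\<close>

locale smooth_manifold =
  fixes \<A> :: "('p::{t2_space,second_countable_topology}, 'n::finite) chart set"
  assumes atlas: "smooth_atlas \<A>"
begin

lemma chart_facts:
  assumes "(U, \<phi>) \<in> \<A>"
  shows "open U" "open (\<phi> ` U)" "homeomorphism U (\<phi> ` U) \<phi> (inv_into U \<phi>)"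
    "q \<in> U \<Longrightarrow> inv_into U \<phi> (\<phi> q) = q"
    "x \<in> \<phi> ` U \<Longrightarrow> inv_into U \<phi> x \<in> U \<and> \<phi> (inv_into U \<phi> x) = x"
proof -
  show h: "open U" "open (\<phi> ` U)" "homeomorphism U (\<phi> ` U) \<phi> (inv_into U \<phi>)"
    using atlas assms unfolding smooth_atlas_def by blast+
  show "q \<in> U \<Longrightarrow> inv_into U \<phi> (\<phi> q) = q"
    using h(3) by (auto simp: homeomorphism_def)
  show "x \<in> \<phi> ` U \<Longrightarrow> inv_into U \<phi> x \<in> U \<and> \<phi> (inv_into U \<phi> x) = x"
    by (meson f_inv_into_f inv_into_into)
qed

lemma chart_at_obtain:
  obtains U \<phi> where "chart_at \<A> q = (U, \<phi>)" "(U, \<phi>) \<in> \<A>" "q \<in> U"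
proof -
  have "\<exists>c. c \<in> \<A> \<and> q \<in> fst c"
    using atlas unfolding smooth_atlas_def by force
  from someI_ex[OF this] have "chart_at \<A> q \<in> \<A> \<and> q \<in> fst (chart_at \<A> q)"
    unfolding chart_at_def .
  then show ?thesis using that by (cases "chart_at \<A> q") auto
qed

lemma open_chart_image:
  assumes "(U, \<phi>) \<in> \<A>" "open V"
  shows "open (\<phi> ` (U \<inter> V))"
proof -
  have "openin (top_of_set (\<phi> ` U)) (\<phi> ` (U \<inter> V))"
    using homeomorphism_imp_open_map[OF chart_facts(3)[OF assms(1)], of "U \<inter> V"] assms(2)
    by (auto simp: openin_open)
  then show ?thesis using openin_open_trans chart_facts(2)[OF assms(1)] by blast
qed

lemma transition_differentiable:
  assumes "(U, \<phi>) \<in> \<A>" "(V, \<psi>) \<in> \<A>" "q \<in> U" "q \<in> V"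
  shows "(\<psi> \<circ> inv_into U \<phi>) differentiable at (\<phi> q)"
  using smooth_on_differentiable[of "\<phi> ` (U \<inter> V)" "\<psi> \<circ> inv_into U \<phi>" "\<phi> q"] assms atlas
  unfolding smooth_atlas_def by blast

text \<open>Chain rule through the transition map: \<open>mderiv \<A> \<psi> q u\<close> converts
  \<open>u\<close> from the chart chosen at \<open>q\<close> to \<psi>. It links
  \<open>mderiv\<close>, whose chart jumps with the point, to a fixed chart in which smoothness can
  be tested.\<close>

lemma mderiv_chart:
  assumes "(V, \<psi>) \<in> \<A>" "q \<in> V" "(f \<circ> inv_into V \<psi>) differentiable at (\<psi> q)"
  shows "mderiv \<A> f q u = frechet_derivative (f \<circ> inv_into V \<psi>) (at (\<psi> q)) (mderiv \<A> \<psi> q u)"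
proof -
  obtain U \<phi> where U: "chart_at \<A> q = (U, \<phi>)" "(U, \<phi>) \<in> \<A>" "q \<in> U"
    by (rule chart_at_obtain)
  let ?h = "\<psi> \<circ> inv_into U \<phi>" and ?k = "f \<circ> inv_into V \<psi>"
  have S: "open (\<phi> ` (U \<inter> V))" "\<phi> q \<in> \<phi> ` (U \<inter> V)"
    using open_chart_image[OF U(2) chart_facts(1)[OF assms(1)]] U(3) assms(2) by auto
  have hq: "?h (\<phi> q) = \<psi> q" using chart_facts(4)[OF U(2,3)] by simp
  have eq: "(f \<circ> inv_into U \<phi>) x = (?k \<circ> ?h) x" if x: "x \<in> \<phi> ` (U \<inter> V)" for x
  proof -
    obtain r where r: "r \<in> U" "r \<in> V" "x = \<phi> r" using x by blast
    then show ?thesis using chart_facts(4)[OF U(2)] chart_facts(4)[OF assms(1)] by simp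
  qed
  from frechet_derivative_cong_open[OF S, of "f \<circ> inv_into U \<phi>" "?k \<circ> ?h", OF eq]
  have "mderiv \<A> f q u = frechet_derivative (?k \<circ> ?h) (at (\<phi> q)) u"
    by (simp add: mderiv_def U(1))
  also have "\<dots> = frechet_derivative ?k (at (\<psi> q)) (frechet_derivative ?h (at (\<phi> q)) u)"
    using frechet_derivative_compose[of ?h "\<phi> q" ?k]
      transition_differentiable[OF U(2) assms(1) U(3) assms(2)] assms(3)
    by (simp add: hq del: comp_apply) (simp add: comp_def)
  finally show ?thesis by (simp add: mderiv_def U(1))
qed

lemma smooth_map_differentiable:
  assumes "smooth_map \<A> f" "(U, \<phi>) \<in> \<A>" "q \<in> U"
  shows "(f \<circ> inv_into U \<phi>) differentiable at (\<phi> q)"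
  using smooth_on_differentiable[of "\<phi> ` U" "f \<circ> inv_into U \<phi>" "\<phi> q"] assms
  unfolding smooth_map_def by blast

lemma smooth_mapD:
  "smooth_map \<A> f \<Longrightarrow> (U, \<phi>) \<in> \<A> \<Longrightarrow> smooth_on (\<phi> ` U) (\<lambda>x. f (inv_into U \<phi> x))"
  unfolding smooth_map_def comp_def by blast

lemma smooth_mapI:
  "(\<And>U \<phi>. (U, \<phi>) \<in> \<A> \<Longrightarrow> smooth_on (\<phi> ` U) (\<lambda>x. f (inv_into U \<phi> x))) \<Longrightarrow> smooth_map \<A> f"
  unfolding smooth_map_def comp_def by blast

lemma smooth_map_const: "smooth_map \<A> (\<lambda>q. c)"
  by (rule smooth_mapI) (rule smooth_on_const)

lemma smooth_map_add:
  "smooth_map \<A> f \<Longrightarrow> smooth_map \<A> h \<Longrightarrow> smooth_map \<A> (\<lambda>q. f q + h q)"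
  by (rule smooth_mapI, rule smooth_on_add) (auto intro: chart_facts smooth_mapD)

lemma smooth_map_bounded_linear:
  "bounded_linear h \<Longrightarrow> smooth_map \<A> f \<Longrightarrow> smooth_map \<A> (\<lambda>q. h (f q))"
  by (rule smooth_mapI, rule smooth_on_bounded_linear) (auto intro: chart_facts smooth_mapD)

lemma smooth_map_bounded_bilinear:
  "bounded_bilinear h \<Longrightarrow> smooth_map \<A> f \<Longrightarrow> smooth_map \<A> k \<Longrightarrow> smooth_map \<A> (\<lambda>q. h (f q) (k q))"
  by (rule smooth_mapI, rule smooth_on_bounded_bilinear) (auto intro: chart_facts smooth_mapD)

lemma smooth_map_inner:
  fixes f h :: "'p \<Rightarrow> 'b::real_inner"
  shows "smooth_map \<A> f \<Longrightarrow> smooth_map \<A> h \<Longrightarrow> smooth_map \<A> (\<lambda>q. f q \<bullet> h q)"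
  by (rule smooth_map_bounded_bilinear[OF bounded_bilinear_inner])

lemma smooth_map_scaleR:
  "smooth_map \<A> f \<Longrightarrow> smooth_map \<A> h \<Longrightarrow> smooth_map \<A> (\<lambda>q. f q *\<^sub>R h q)"
  by (rule smooth_map_bounded_bilinear[OF bounded_bilinear_scaleR])

lemma smooth_map_minus: "smooth_map \<A> f \<Longrightarrow> smooth_map \<A> (\<lambda>q. - f q)"
  by (rule smooth_map_bounded_linear[OF bounded_linear_minus[OF bounded_linear_ident]])

lemma smooth_map_diff:
  "smooth_map \<A> f \<Longrightarrow> smooth_map \<A> h \<Longrightarrow> smooth_map \<A> (\<lambda>q. f q - h q)"
  using smooth_map_add[OF _ smooth_map_minus, of f h] by simp

lemma smooth_map_nth: "smooth_map \<A> f \<Longrightarrow> smooth_map \<A> (\<lambda>q. f q $ i :: real)"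
  by (rule smooth_map_bounded_linear[OF bounded_linear_vec_nth])

section \<open>Differentiation rules for maps on the manifold\<close>

lemma mderiv_has_derivative:
  assumes "smooth_map \<A> f" "chart_at \<A> q = (U, \<phi>)" "(U, \<phi>) \<in> \<A>" "q \<in> U"
  shows "((\<lambda>x. f (inv_into U \<phi> x)) has_derivative mderiv \<A> f q) (at (\<phi> q))"
proof -
  have "mderiv \<A> f q = frechet_derivative (f \<circ> inv_into U \<phi>) (at (\<phi> q))"
    by (rule ext) (simp add: mderiv_def assms(2))
  then show ?thesis
    using smooth_map_differentiable[OF assms(1,3,4)] unfolding frechet_derivative_works comp_def by simp
qed

text \<open>\<open>mderiv\<close> at \<open>q\<close> looks into a single chart, so a derivative in
  that chart determines it; the rules below are Euclidean rules fed through this lemma.\<close>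

lemma mderivI:
  assumes "\<And>U \<phi>. chart_at \<A> q = (U, \<phi>) \<Longrightarrow> (U, \<phi>) \<in> \<A> \<Longrightarrow> q \<in> U \<Longrightarrow> inv_into U \<phi> (\<phi> q) = q \<Longrightarrow>
    ((\<lambda>x. f (inv_into U \<phi> x)) has_derivative D) (at (\<phi> q))"
  shows "mderiv \<A> f q = D"
proof -
  obtain U \<phi> where U: "chart_at \<A> q = (U, \<phi>)" "(U, \<phi>) \<in> \<A>" "q \<in> U"
    by (rule chart_at_obtain)
  have "mderiv \<A> f q = frechet_derivative (\<lambda>x. f (inv_into U \<phi> x)) (at (\<phi> q))"
    by (rule ext) (simp add: mderiv_def U(1) comp_def)
  then show ?thesis
    using frechet_derivative_at[OF assms[OF U chart_facts(4)[OF U(2,3)]]] by simp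
qed

lemma linear_mderiv:
  assumes "smooth_map \<A> f"
  shows "linear (mderiv \<A> f q)"
proof -
  obtain U \<phi> where U: "chart_at \<A> q = (U, \<phi>)" "(U, \<phi>) \<in> \<A>" "q \<in> U"
    by (rule chart_at_obtain)
  show ?thesis using mderiv_has_derivative[OF assms U] by (rule has_derivative_linear)
qed

lemma mderiv_const: "mderiv \<A> (\<lambda>q. c) q u = 0"
  by (subst mderivI[of q "\<lambda>q. c" "\<lambda>_. 0"]) auto

lemma mderiv_add:
  assumes "smooth_map \<A> f" "smooth_map \<A> h"
  shows "mderiv \<A> (\<lambda>q. f q + h q) q u = mderiv \<A> f q u + mderiv \<A> h q u"
  by (subst mderivI[of q "\<lambda>q. f q + h q" "\<lambda>u. mderiv \<A> f q u + mderiv \<A> h q u"])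
    (auto intro!: has_derivative_add mderiv_has_derivative assms)

lemma mderiv_bounded_linear:
  assumes "bounded_linear h" "smooth_map \<A> f"
  shows "mderiv \<A> (\<lambda>q. h (f q)) q u = h (mderiv \<A> f q u)"
  by (subst mderivI[of q "\<lambda>q. h (f q)" "\<lambda>u. h (mderiv \<A> f q u)"])
    (auto intro!: bounded_linear.has_derivative[OF assms(1)] mderiv_has_derivative assms)

lemma mderiv_bounded_bilinear:
  assumes "bounded_bilinear h" "smooth_map \<A> f" "smooth_map \<A> k"
  shows "mderiv \<A> (\<lambda>q. h (f q) (k q)) q u = h (f q) (mderiv \<A> k q u) + h (mderiv \<A> f q u) (k q)"
proof (subst mderivI[of q _ "\<lambda>u. h (f q) (mderiv \<A> k q u) + h (mderiv \<A> f q u) (k q)"])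
  fix U \<phi> assume U: "chart_at \<A> q = (U, \<phi>)" "(U, \<phi>) \<in> \<A>" "q \<in> U" "inv_into U \<phi> (\<phi> q) = q"
  show "((\<lambda>x. h (f (inv_into U \<phi> x)) (k (inv_into U \<phi> x))) has_derivative
      (\<lambda>u. h (f q) (mderiv \<A> k q u) + h (mderiv \<A> f q u) (k q))) (at (\<phi> q))"
    using bounded_bilinear.FDERIV[OF assms(1) mderiv_has_derivative[OF assms(2) U(1-3)]
        mderiv_has_derivative[OF assms(3) U(1-3)]] unfolding U(4) .
qed simp

lemma mderiv_inner:
  fixes f h :: "'p \<Rightarrow> 'b::real_inner"
  assumes "smooth_map \<A> f" "smooth_map \<A> h"
  shows "mderiv \<A> (\<lambda>q. f q \<bullet> h q) q u = f q \<bullet> mderiv \<A> h q u + mderiv \<A> f q u \<bullet> h q"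
  by (rule mderiv_bounded_bilinear[OF bounded_bilinear_inner assms])

lemma mderiv_scaleR:
  assumes "smooth_map \<A> f" "smooth_map \<A> h"
  shows "mderiv \<A> (\<lambda>q. f q *\<^sub>R h q) q u = f q *\<^sub>R mderiv \<A> h q u + mderiv \<A> f q u *\<^sub>R h q"
  by (rule mderiv_bounded_bilinear[OF bounded_bilinear_scaleR assms])

lemma mderiv_minus:
  assumes "smooth_map \<A> f"
  shows "mderiv \<A> (\<lambda>q. - f q) q u = - mderiv \<A> f q u"
  by (rule mderiv_bounded_linear[OF bounded_linear_minus[OF bounded_linear_ident] assms])

lemma mderiv_diff:
  assumes "smooth_map \<A> f" "smooth_map \<A> h"
  shows "mderiv \<A> (\<lambda>q. f q - h q) q u = mderiv \<A> f q u - mderiv \<A> h q u"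
  using mderiv_add[OF assms(1) smooth_map_minus[OF assms(2)]] mderiv_minus[OF assms(2)] by simp

lemma smooth_map_mderiv:
  assumes "smooth_map \<A> f" "smooth_field \<A> X"
  shows "smooth_map \<A> (\<lambda>q. mderiv \<A> f q (X q))"
proof (rule smooth_mapI)
  fix U \<phi> assume U: "(U, \<phi>) \<in> \<A>"
  let ?f = "f \<circ> inv_into U \<phi>" and ?X = "(\<lambda>q. mderiv \<A> \<phi> q (X q)) \<circ> inv_into U \<phi>"
  have "frechet_derivative ?f (at x) (?X x) = mderiv \<A> f (inv_into U \<phi> x) (X (inv_into U \<phi> x))"
    if x: "x \<in> \<phi> ` U" for x
  proof -
    note i = chart_facts(5)[OF U x]
    have "?f differentiable at (\<phi> (inv_into U \<phi> x))"
      by (rule smooth_map_differentiable[OF assms(1) U]) (use i in auto)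
    from mderiv_chart[OF U _ this] i show ?thesis by (simp add: comp_def)
  qed
  moreover have "smooth_on (\<phi> ` U) (\<lambda>x. frechet_derivative ?f (at x) (?X x))"
  proof (rule smooth_on_frechet[OF chart_facts(2)[OF U]])
    show "smooth_on (\<phi> ` U) ?f" using assms(1) U unfolding smooth_map_def by blast
    show "smooth_on (\<phi> ` U) ?X" using assms(2) U unfolding smooth_field_def by blast
  qed
  ultimately show "smooth_on (\<phi> ` U) (\<lambda>x. mderiv \<A> f (inv_into U \<phi> x) (X (inv_into U \<phi> x)))"
    by (rule smooth_on_cong[OF chart_facts(2)[OF U]])
qed

text \<open>In a fixed chart the components of \<open>X\<close> solve a linear system whose matrix
  is the Jacobian of \<open>F\<close> and whose right side is \<open>dF X\<close>;
  \<open>smooth_on_solve\<close> makes the solution smooth.\<close>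

lemma smooth_fieldI:
  fixes F :: "'p \<Rightarrow> real^'m"
  assumes F: "smooth_map \<A> F" and inj: "\<And>q. inj (mderiv \<A> F q)"
    and V: "smooth_map \<A> (\<lambda>q. mderiv \<A> F q (X q))"
  shows "smooth_field \<A> X"
  unfolding smooth_field_def
proof clarify
  fix U \<phi> assume U: "(U, \<phi>) \<in> \<A>"
  let ?F = "F \<circ> inv_into U \<phi>"
  have Fq: "mderiv \<A> F (inv_into U \<phi> x) u =
      frechet_derivative ?F (at x) (mderiv \<A> \<phi> (inv_into U \<phi> x) u)" if x: "x \<in> \<phi> ` U" for x u
  proof -
    note i = chart_facts(5)[OF U x]
    have "?F differentiable at (\<phi> (inv_into U \<phi> x))"
      by (rule smooth_map_differentiable[OF F U]) (use i in auto)
    from mderiv_chart[OF U _ this] i show ?thesis by (simp add: comp_def)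
  qed
  have dF: "?F differentiable at x" if x: "x \<in> \<phi> ` U" for x
    using smooth_map_differentiable[OF F U, of "inv_into U \<phi> x"] chart_facts(5)[OF U x] by auto
  have lin\<phi>: "linear (mderiv \<A> \<phi> q)" if q: "q \<in> U" for q
  proof -
    obtain V \<psi> where V: "chart_at \<A> q = (V, \<psi>)" "(V, \<psi>) \<in> \<A>" "q \<in> V"
      by (rule chart_at_obtain)
    have "mderiv \<A> \<phi> q = frechet_derivative (\<phi> \<circ> inv_into V \<psi>) (at (\<psi> q))"
      by (rule ext) (simp add: mderiv_def V(1))
    then show ?thesis
      using linear_frechet_derivative[OF transition_differentiable[OF V(2) U V(3) q]] by simp
  qed
  show "smooth_on (\<phi> ` U) ((\<lambda>q. mderiv \<A> \<phi> q (X q)) \<circ> inv_into U \<phi>)"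
  proof (rule smooth_on_solve[OF chart_facts(2)[OF U]])
    show "linear (frechet_derivative ?F (at x))" if "x \<in> \<phi> ` U" for x
      using dF[OF that] by (rule linear_frechet_derivative)
    \<comment> \<open>\<open>dF\<close> is this Jacobian composed with the change of chart
      \<open>?d\<close>. Injectivity of \<open>dF\<close> makes \<open>?d\<close> injective, hence
      onto by dimension, and injectivity passes to the Jacobian.\<close>
    show "inj (frechet_derivative ?F (at x))" if x: "x \<in> \<phi> ` U" for x
    proof -
      let ?d = "mderiv \<A> \<phi> (inv_into U \<phi> x)"
      have comp: "mderiv \<A> F (inv_into U \<phi> x) = frechet_derivative ?F (at x) \<circ> ?d"
        using Fq[OF x] by (auto simp: fun_eq_iff)
      have "inj ?d" using inj[of "inv_into U \<phi> x"] unfolding comp by (rule inj_on_imageI2)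
      then have "surj ?d"
        using lin\<phi> chart_facts(5)[OF U x] linear_injective_imp_surjective by blast
      then show ?thesis
        using inj[of "inv_into U \<phi> x"] \<open>inj ?d\<close> unfolding comp
        by (metis comp_inj_on_iff)
    qed
    show "smooth_on (\<phi> ` U) (\<lambda>x. frechet_derivative ?F (at x) v)" for v
      by (rule smooth_on_frechet[OF chart_facts(2)[OF U] _ smooth_on_const])
        (use F U in \<open>auto simp: smooth_map_def\<close>)
    show "smooth_on (\<phi> ` U) (\<lambda>x. mderiv \<A> F (inv_into U \<phi> x) (X (inv_into U \<phi> x)))"
      by (rule smooth_mapD[OF V U])
    show "frechet_derivative ?F (at x) (((\<lambda>q. mderiv \<A> \<phi> q (X q)) \<circ> inv_into U \<phi>) x) =
        mderiv \<A> F (inv_into U \<phi> x) (X (inv_into U \<phi> x))" if "x \<in> \<phi> ` U" for x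
      using Fq[OF that] by simp
  qed
qed

end


section \<open>Hypersurfaces of the sphere\<close>

locale sphere_hypersurface_lc = smooth_manifold \<A>
  for \<A> :: "('p::{t2_space,second_countable_topology}, 'n::finite) chart set" +
  fixes F \<nu> :: "'p \<Rightarrow> real^'m"
    and D :: "('p \<Rightarrow> real^'n) \<Rightarrow> ('p \<Rightarrow> real^'n) \<Rightarrow> ('p \<Rightarrow> real^'n)"
  assumes hyp: "sphere_hypersurface \<A> F \<nu>"
    and lc: "levi_civita \<A> (induced_metric \<A> F) D"
begin

abbreviation "dF \<equiv> mderiv \<A> F"
abbreviation "S \<equiv> shape_operator \<A> F \<nu>"
abbreviation "ip \<equiv> induced_metric \<A> F"
abbreviation "smf \<equiv> smooth_field \<A>"

lemma hypersurface_facts: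
  shows smooth_F: "smooth_map \<A> F" and smooth_nu: "smooth_map \<A> \<nu>"
    and inj_dF: "inj (dF q)" and F_F: "F q \<bullet> F q = 1" and nu_nu: "\<nu> q \<bullet> \<nu> q = 1"
    and nu_F: "\<nu> q \<bullet> F q = 0" and nu_dF: "\<nu> q \<bullet> dF q u = 0"
    and card: "CARD('m) = CARD('n) + 2"
  using hyp unfolding sphere_hypersurface_def smooth_embedding_def
  by (auto simp: dot_square_norm)

lemmas linear_dF = linear_mderiv[OF smooth_F]
lemmas dF_add = linear_add[OF linear_dF] and dF_diff = linear_diff[OF linear_dF]
  and dF_scale = linear_cmul[OF linear_dF] and dF_0 = linear_0[OF linear_dF]

lemma dF_eq_iff: "dF q u = dF q v \<longleftrightarrow> u = v"
  using inj_dF[of q] by (auto dest: injD)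

lemma F_dF: "F q \<bullet> dF q u = 0"
proof -
  have "mderiv \<A> (\<lambda>q. F q \<bullet> F q) q u = 2 * (F q \<bullet> dF q u)"
    by (simp add: mderiv_inner[OF smooth_F smooth_F] inner_commute)
  moreover have "mderiv \<A> (\<lambda>q. F q \<bullet> F q) q u = 0"
    by (simp add: F_F mderiv_const)
  ultimately show ?thesis by simp
qed

text \<open>Dimension count: \<open>F q\<close> and \<open>\<nu> q\<close> are orthonormal, so their
  complement has dimension \<open>n + 2 - 2 = n\<close>, the rank of the injective
  \<open>dF q\<close>.\<close>

lemma range_dF: "range (dF q) = {v. F q \<bullet> v = 0 \<and> \<nu> q \<bullet> v = 0}"
proof -
  let ?T = "{v. F q \<bullet> v = 0 \<and> \<nu> q \<bullet> v = 0}"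
  have 1: "subspace (range (dF q))"
    using linear_dF by (simp add: linear_subspace_image)
  have T: "subspace ?T" by (auto simp: subspace_def inner_add_right)
  have sub: "range (dF q) \<subseteq> ?T" using F_dF nu_dF by auto
  let ?B = "{F q, \<nu> q}"
  have ne: "F q \<noteq> \<nu> q" using nu_F[of q] nu_nu[of q] by auto
  have "independent ?B"
    by (rule pairwise_orthogonal_independent)
      (use nu_F[of q] F_F[of q] nu_nu[of q] in \<open>auto simp: pairwise_def orthogonal_def inner_commute\<close>)
  then have 2: "dim (span ?B) = 2"
    using ne by (simp add: dim_eq_card_independent)
  have "dim {y \<in> UNIV. \<forall>x\<in>span ?B. orthogonal x y} + dim (span ?B) = dim (UNIV :: (real^'m) set)"
    by (rule dim_subspace_orthogonal_to_vectors) auto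
  moreover have "?T \<subseteq> {y \<in> UNIV. \<forall>x\<in>span ?B. orthogonal x y}"
  proof (intro subsetI CollectI conjI ballI UNIV_I)
    fix y x assume y: "y \<in> ?T" and x: "x \<in> span ?B"
    have "orthogonal y x" by (rule orthogonal_to_span[OF x]) (use y in \<open>auto simp: orthogonal_def inner_commute\<close>)
    then show "orthogonal x y" by (simp add: orthogonal_commute)
  qed
  ultimately have "dim ?T \<le> CARD('n)"
    using dim_subset[of ?T "{y \<in> UNIV. \<forall>x\<in>span ?B. orthogonal x y}"] 2 card by simp
  then have "dim ?T \<le> dim (range (dF q))"
    using dim_image_eq[OF linear_dF[of q], of UNIV] inj_dF[of q] by (simp add: span_UNIV)
  from subspace_dim_equal[OF 1 T sub this] show ?thesis .
qed

text \<open>Differentiating \<open>\<nu> \<bullet> \<nu> = 1\<close> and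
  \<open>\<nu> \<bullet> F = 0\<close> shows that the derivative of \<nu> is tangential, so the
  description in \<open>shape_operator\<close> has a solution, unique since \<open>dF\<close> is
  injective.\<close>

lemma dF_shape: "dF q (S q u) = - mderiv \<A> \<nu> q u"
proof -
  have "\<nu> q \<bullet> mderiv \<A> \<nu> q u = 0"
  proof -
    have "mderiv \<A> (\<lambda>q. \<nu> q \<bullet> \<nu> q) q u = 2 * (\<nu> q \<bullet> mderiv \<A> \<nu> q u)"
      by (simp add: mderiv_inner[OF smooth_nu smooth_nu] inner_commute)
    moreover have "mderiv \<A> (\<lambda>q. \<nu> q \<bullet> \<nu> q) q u = 0"
      by (simp add: nu_nu mderiv_const)
    ultimately show ?thesis by simp
  qed
  moreover have "F q \<bullet> mderiv \<A> \<nu> q u = 0"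
  proof -
    have "mderiv \<A> (\<lambda>q. \<nu> q \<bullet> F q) q u = F q \<bullet> mderiv \<A> \<nu> q u"
      unfolding mderiv_inner[OF smooth_nu smooth_F] nu_dF by (simp add: inner_commute)
    moreover have "mderiv \<A> (\<lambda>q. \<nu> q \<bullet> F q) q u = 0"
      by (simp add: nu_F mderiv_const)
    ultimately show ?thesis by simp
  qed
  ultimately have "- mderiv \<A> \<nu> q u \<in> range (dF q)" unfolding range_dF by simp
  then obtain w where "- mderiv \<A> \<nu> q u = dF q w" by blast
  then have w: "mderiv \<A> \<nu> q u = - dF q w" by (simp add: minus_equation_iff)
  have "S q u = w"
    unfolding shape_operator_def by (rule the_equality) (simp_all add: w dF_eq_iff)
  then show ?thesis using w by simp
qed

lemma linear_S: "linear (S q)"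
proof (rule linearI)
  fix u v c
  have "dF q (S q (u + v)) = dF q (S q u + S q v)"
    unfolding dF_add dF_shape linear_add[OF linear_mderiv[OF smooth_nu]] by simp
  then show "S q (u + v) = S q u + S q v" unfolding dF_eq_iff .
  have "dF q (S q (c *\<^sub>R u)) = dF q (c *\<^sub>R S q u)"
    unfolding dF_scale dF_shape linear_cmul[OF linear_mderiv[OF smooth_nu]] by simp
  then show "S q (c *\<^sub>R u) = c *\<^sub>R S q u" unfolding dF_eq_iff .
qed

lemmas S_add = linear_add[OF linear_S] and S_diff = linear_diff[OF linear_S]
  and S_scale = linear_cmul[OF linear_S] and S_0 = linear_0[OF linear_S]

lemma ip_commute: "ip q u v = ip q v u"
  by (simp add: induced_metric_def inner_commute)

lemma ip_linear:
  "ip q (u + u') v = ip q u v + ip q u' v" "ip q u (v + v') = ip q u v + ip q u v'"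
  "ip q (u - u') v = ip q u v - ip q u' v" "ip q u (v - v') = ip q u v - ip q u v'"
  "ip q (c *\<^sub>R u) v = c * ip q u v" "ip q u (c *\<^sub>R v) = c * ip q u v"
  "ip q 0 v = 0" "ip q u 0 = 0"
  by (simp_all add: induced_metric_def dF_add dF_diff dF_scale dF_0 inner_left_distrib
      inner_right_distrib inner_diff_left inner_diff_right)

lemma ip_pos: "u \<noteq> 0 \<Longrightarrow> ip q u u > 0"
  using dF_eq_iff[of q u 0] by (simp add: induced_metric_def dF_0)

lemma ip_eqI: "(\<And>w. ip q u w = ip q v w) \<Longrightarrow> u = v"
proof -
  assume "\<And>w. ip q u w = ip q v w"
  then have "ip q (u - v) (u - v) = 0" by (simp add: ip_linear)
  then show ?thesis using ip_pos[of "u - v" q] by force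
qed

lemma smooth_fieldI': "smooth_map \<A> (\<lambda>q. dF q (X q)) \<Longrightarrow> smf X"
  by (rule smooth_fieldI[OF smooth_F inj_dF])

lemma smooth_dF: "smf X \<Longrightarrow> smooth_map \<A> (\<lambda>q. dF q (X q))"
  by (rule smooth_map_mderiv[OF smooth_F])

lemma smf_add: "smf X \<Longrightarrow> smf Y \<Longrightarrow> smf (\<lambda>q. X q + Y q)"
  by (rule smooth_fieldI', unfold dF_add) (intro smooth_map_add smooth_dF)

lemma smf_diff: "smf X \<Longrightarrow> smf Y \<Longrightarrow> smf (\<lambda>q. X q - Y q)"
  by (rule smooth_fieldI', unfold dF_diff) (intro smooth_map_diff smooth_dF)

lemma smf_scale: "smf X \<Longrightarrow> smf (\<lambda>q. c *\<^sub>R X q)"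
  by (rule smooth_fieldI', unfold dF_scale) (intro smooth_map_scaleR[OF smooth_map_const] smooth_dF)

lemma smf_S: "smf X \<Longrightarrow> smf (\<lambda>q. S q (X q))"
  by (rule smooth_fieldI', unfold dF_shape) (intro smooth_map_minus smooth_map_mderiv[OF smooth_nu])

text \<open>The tangential projection of a constant vector of the ambient space is a global smooth
  field, so no cut-off functions are needed.\<close>

lemma smooth_extension:
  obtains U where "smf U" "U q = u"
proof -
  define v where "v = dF q u"
  have "\<exists>w. dF r w = v - (F r \<bullet> v) *\<^sub>R F r - (\<nu> r \<bullet> v) *\<^sub>R \<nu> r" for r
  proof -
    have "v - (F r \<bullet> v) *\<^sub>R F r - (\<nu> r \<bullet> v) *\<^sub>R \<nu> r \<in> range (dF r)"
      unfolding range_dF using nu_F[of r]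
      by (simp add: inner_diff_right F_F nu_nu nu_F inner_commute[of "F r" "\<nu> r"])
    then obtain w where "v - (F r \<bullet> v) *\<^sub>R F r - (\<nu> r \<bullet> v) *\<^sub>R \<nu> r = dF r w" by (rule rangeE)
    from this[symmetric] show ?thesis by (rule exI)
  qed
  then have "\<forall>r. \<exists>w. dF r w = v - (F r \<bullet> v) *\<^sub>R F r - (\<nu> r \<bullet> v) *\<^sub>R \<nu> r" by (rule allI)
  from choice[OF this] obtain U where
    U: "dF r (U r) = v - (F r \<bullet> v) *\<^sub>R F r - (\<nu> r \<bullet> v) *\<^sub>R \<nu> r" for r by blast
  have "smf U"
    by (rule smooth_fieldI', unfold U)
      (rule smooth_map_diff smooth_map_scaleR smooth_map_inner smooth_map_const smooth_F smooth_nu)+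
  moreover have "U q = u"
    using U[of q] F_dF[of q u] nu_dF[of q u] by (simp add: v_def dF_eq_iff)
  ultimately show ?thesis by (rule that)
qed

section \<open>The Levi-Civita connection and the ambient derivative\<close>

lemma D_smooth: "smf X \<Longrightarrow> smf Y \<Longrightarrow> smf (D X Y)"
  using conjunct1[OF lc[unfolded levi_civita_def]] by blast

lemma D_metric:
  assumes "smf X" "smf Y" "smf Z"
  shows "mderiv \<A> (\<lambda>q. ip q (Y q) (Z q)) p (X p) = ip p (D X Y p) (Z p) + ip p (Y p) (D X Z p)"
  using lc assms unfolding levi_civita_def by blast

lemma D_torsion_real:
  fixes f :: "'p \<Rightarrow> real"
  assumes "smooth_map \<A> f" "smf X" "smf Y"
  shows "mderiv \<A> f p (D X Y p - D Y X p) =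
    mderiv \<A> (\<lambda>q. mderiv \<A> f q (Y q)) p (X p) - mderiv \<A> (\<lambda>q. mderiv \<A> f q (X q)) p (Y p)"
  using lc assms unfolding levi_civita_def by blast

text \<open>\<open>levi_civita\<close> tests the commutator on real functions. Componentwise it may
  be tested on \<open>F\<close>, \<nu> and \<open>dF Z\<close>, which give symmetry of
  \<open>S\<close>, the Codazzi equation and the Gauss equation.\<close>

lemma D_torsion:
  fixes f :: "'p \<Rightarrow> real^'k"
  assumes f: "smooth_map \<A> f" and X: "smf X" and Y: "smf Y"
  shows "mderiv \<A> f p (D X Y p - D Y X p) =
    mderiv \<A> (\<lambda>q. mderiv \<A> f q (Y q)) p (X p) - mderiv \<A> (\<lambda>q. mderiv \<A> f q (X q)) p (Y p)"
proof (rule vec_eq_iff[THEN iffD2], rule allI)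
  fix i
  have nth: "mderiv \<A> h q u $ i = mderiv \<A> (\<lambda>q. h q $ i) q u" if "smooth_map \<A> h"
    for h :: "'p \<Rightarrow> real^'k" and q u
    by (rule mderiv_bounded_linear[OF bounded_linear_vec_nth that, symmetric])
  have fi: "smooth_map \<A> (\<lambda>q. f q $ i)" using f by (rule smooth_map_nth)
  show "mderiv \<A> f p (D X Y p - D Y X p) $ i = (mderiv \<A> (\<lambda>q. mderiv \<A> f q (Y q)) p (X p) -
      mderiv \<A> (\<lambda>q. mderiv \<A> f q (X q)) p (Y p)) $ i"
    using D_torsion_real[OF fi X Y, of p]
    by (simp only: vector_minus_component nth[OF f] nth[OF smooth_map_mderiv[OF f X]]
        nth[OF smooth_map_mderiv[OF f Y]])
qed

text \<open>Koszul's argument: the difference of the two sides is symmetric in \<open>X\<close>, \<open>Y\<close> and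
  antisymmetric in \<open>Y\<close>, \<open>Z\<close>.\<close>

lemma D_tangential:
  assumes "smf X" "smf Y"
  shows "mderiv \<A> (\<lambda>q. dF q (Y q)) p (X p) \<bullet> dF p w = ip p (D X Y p) w"
proof -
  define E where "E X Y Z = dF p (D X Y p) \<bullet> dF p (Z p) -
    mderiv \<A> (\<lambda>q. dF q (Y q)) p (X p) \<bullet> dF p (Z p)" for X Y Z
  have sym: "E X Y Z = E Y X Z" if "smf X" "smf Y" for X Y Z
  proof -
    have "dF p (D X Y p) - mderiv \<A> (\<lambda>q. dF q (Y q)) p (X p) =
        dF p (D Y X p) - mderiv \<A> (\<lambda>q. dF q (X q)) p (Y p)"
      using D_torsion[OF smooth_F that, of p] by (simp add: dF_diff algebra_simps)
    then show ?thesis by (simp only: E_def flip: inner_diff_left)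
  qed
  have asym: "E X Y Z = - E X Z Y" if "smf X" "smf Y" "smf Z" for X Y Z
    using D_metric[OF that, of p] mderiv_inner[OF smooth_dF[OF that(2)] smooth_dF[OF that(3)], of p "X p"]
    by (simp add: E_def induced_metric_def inner_commute)
  obtain Z where Z: "smf Z" "Z p = w" by (rule smooth_extension)
  \<comment> \<open>Alternating \<open>sym\<close> and \<open>asym\<close> three times each returns
    to \<open>E X Y Z\<close> after three changes of sign.\<close>
  have "E X Y Z = - E X Y Z"
    using sym[OF assms, of Z] asym[OF assms(2,1) Z(1)] sym[OF assms(2) Z(1), of X]
      asym[OF Z(1) assms(2,1)] sym[OF Z(1) assms(1), of Y] asym[OF assms(1) Z(1) assms(2)] by simp
  then show ?thesis using Z(2) by (simp add: E_def induced_metric_def)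
qed

text \<open>The difference \<open>R\<close> is orthogonal to the tangent space by
  \<open>D_tangential\<close>; without its components along \<open>F\<close> and \<nu> it is also
  tangential, hence zero. The two coefficients come from differentiating
  \<open>\<nu> \<bullet> dF Y = 0\<close> and \<open>F \<bullet> dF Y = 0\<close>.\<close>

lemma gauss_formula:
  assumes X: "smf X" and Y: "smf Y"
  shows "mderiv \<A> (\<lambda>q. dF q (Y q)) p (X p) =
    dF p (D X Y p) + ip p (S p (X p)) (Y p) *\<^sub>R \<nu> p - ip p (X p) (Y p) *\<^sub>R F p"
proof -
  define R where "R = mderiv \<A> (\<lambda>q. dF q (Y q)) p (X p) - dF p (D X Y p)"
  have tang: "R \<bullet> dF p w = 0" for w
    using D_tangential[OF X Y, of p w] by (simp add: R_def inner_diff_left induced_metric_def)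
  let ?R = "R - (F p \<bullet> R) *\<^sub>R F p - (\<nu> p \<bullet> R) *\<^sub>R \<nu> p"
  have "?R \<in> range (dF p)"
    unfolding range_dF using nu_F[of p]
    by (simp add: inner_diff_right F_F nu_nu nu_F inner_commute[of "F p" "\<nu> p"])
  then obtain w where w: "?R = dF p w" by blast
  have "?R \<bullet> ?R = 0"
    unfolding w using tang[of w] F_dF[of p w] nu_dF[of p w] by (simp add: inner_diff_left flip: w)
  then have "?R = 0" by (simp only: inner_eq_zero_iff)
  then have R: "R = (F p \<bullet> R) *\<^sub>R F p + (\<nu> p \<bullet> R) *\<^sub>R \<nu> p" by (simp only: diff_diff_eq right_minus_eq)
  have "mderiv \<A> (\<lambda>q. \<nu> q \<bullet> dF q (Y q)) p (X p) = 0" by (simp add: nu_dF mderiv_const)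
  then have nR: "\<nu> p \<bullet> R = ip p (S p (X p)) (Y p)"
    unfolding mderiv_inner[OF smooth_nu smooth_dF[OF Y]]
    by (simp add: R_def inner_diff_right nu_dF induced_metric_def dF_shape)
  have "mderiv \<A> (\<lambda>q. F q \<bullet> dF q (Y q)) p (X p) = 0" by (simp add: F_dF mderiv_const)
  then have FR: "F p \<bullet> R = - ip p (X p) (Y p)"
    unfolding mderiv_inner[OF smooth_F smooth_dF[OF Y]]
    by (simp add: R_def inner_diff_right F_dF induced_metric_def)
  show ?thesis using R unfolding nR FR by (simp add: R_def algebra_simps)
qed

text \<open>The two mixed second derivatives of \<open>F\<close> differ by a tangent vector, so
  their \<nu>-components in the Gauss formula agree.\<close>

lemma S_self_adjoint: "ip q (S q u) v = ip q u (S q v)"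
proof -
  obtain X where X: "smf X" "X q = u" by (rule smooth_extension)
  obtain Y where Y: "smf Y" "Y q = v" by (rule smooth_extension)
  have "dF q (D X Y q - D Y X q) = dF q (D X Y q) - dF q (D Y X q) +
      (ip q (S q u) v - ip q (S q v) u) *\<^sub>R \<nu> q"
    using D_torsion[OF smooth_F X(1) Y(1), of q] gauss_formula[OF X(1) Y(1), of q]
      gauss_formula[OF Y(1) X(1), of q] ip_commute[of q u v]
    unfolding X(2) Y(2) by (simp add: scaleR_diff_left)
  then have "(ip q (S q u) v - ip q (S q v) u) *\<^sub>R \<nu> q = 0" by (simp add: dF_diff)
  then show ?thesis using nu_nu[of q] by (auto simp: ip_commute)
qed

section \<open>The covariant derivative of the shape operator\<close>

definition covS :: "('p \<Rightarrow> real^'n) \<Rightarrow> ('p \<Rightarrow> real^'n) \<Rightarrow> 'p \<Rightarrow> real^'n" where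
  "covS U V p = D U (\<lambda>q. S q (V q)) p - S p (D U V p)"

text \<open>Apply \<open>D_torsion\<close> to \<nu>, whose derivative is \<open>- dF S\<close>. In
  the Gauss formulas for the two orders the coefficients of \<nu> and \<open>F\<close> agree by
  self-adjointness, and the tangential parts remain.\<close>

lemma codazzi:
  assumes X: "smf X" and Y: "smf Y"
  shows "covS X Y p = covS Y X p"
proof -
  have d: "mderiv \<A> (\<lambda>q. mderiv \<A> \<nu> q (V q)) p (U p) = - (dF p (D U (\<lambda>q. S q (V q)) p) +
      ip p (S p (U p)) (S p (V p)) *\<^sub>R \<nu> p - ip p (U p) (S p (V p)) *\<^sub>R F p)"
    if "smf U" "smf V" for U V
  proof -
    have "(\<lambda>q. mderiv \<A> \<nu> q (V q)) = (\<lambda>q. - dF q (S q (V q)))" by (simp add: dF_shape)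
    then show ?thesis
      using mderiv_minus[OF smooth_dF[OF smf_S[OF that(2)]], of p "U p"]
        gauss_formula[OF that(1) smf_S[OF that(2)], of p] by simp
  qed
  have "mderiv \<A> \<nu> p (D X Y p - D Y X p) = - dF p (S p (D X Y p - D Y X p))"
    by (simp add: dF_shape)
  then have "dF p (S p (D X Y p - D Y X p)) =
      dF p (D X (\<lambda>q. S q (Y q)) p) - dF p (D Y (\<lambda>q. S q (X q)) p)"
    using D_torsion[OF smooth_nu X Y, of p] d[OF X Y] d[OF Y X]
      S_self_adjoint[of p "X p" "Y p"] ip_commute[of p "S p (X p)" "Y p"]
      ip_commute[of p "S p (X p)" "S p (Y p)"]
    by (simp add: algebra_simps)
  then have "S p (D X Y p - D Y X p) = D X (\<lambda>q. S q (Y q)) p - D Y (\<lambda>q. S q (X q)) p"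
    by (simp add: dF_diff[symmetric] dF_eq_iff)
  then show ?thesis by (simp add: covS_def S_diff algebra_simps)
qed

lemma ip_covS:
  assumes "smf U" "smf V"
  shows "ip p (covS U V p) w = mderiv \<A> (\<lambda>q. dF q (S q (V q))) p (U p) \<bullet> dF p w -
    mderiv \<A> (\<lambda>q. dF q (V q)) p (U p) \<bullet> dF p (S p w)"
  by (simp add: D_tangential[OF assms(1) smf_S[OF assms(2)]] D_tangential[OF assms] covS_def
      ip_linear S_self_adjoint)

text \<open>On the right of \<open>ip_covS\<close> the field \<open>U\<close> occurs only through
  \<open>U p\<close>; \<open>codazzi\<close> exchanges the slots and settles
  \<open>V\<close>.\<close>

lemma covS_cong:
  assumes "smf U" "smf V" "smf U'" "smf V'" "U p = U' p" "V p = V' p"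
  shows "covS U V p = covS U' V' p"
proof -
  have *: "covS U V p = covS U' V p" if "smf U" "smf V" "smf U'" "U p = U' p" for U U' V
    by (rule ip_eqI[of p]) (simp only: ip_covS[OF that(1,2)] ip_covS[OF that(3,2)] that(4))
  show ?thesis
    using *[OF assms(1,2,3,5)] *[OF assms(2,3,4,6)] codazzi[OF assms(3,2), of p] codazzi[OF assms(3,4), of p]
    by simp
qed

abbreviation "cov \<equiv> cov_deriv_shape \<A> F \<nu> D"

text \<open>Tensoriality makes the description in \<open>cov_deriv_shape\<close> well defined; from
  here on \<open>cov\<close> may be computed with any convenient extensions, in particular
  eigenfields.\<close>

lemma cov_eq:
  assumes "smf U" "smf V"
  shows "cov p (U p) (V p) = covS U V p"
  unfolding cov_deriv_shape_def
proof (rule the_equality)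
  show "\<forall>U' V'. smf U' \<longrightarrow> smf V' \<longrightarrow> U' p = U p \<longrightarrow> V' p = V p \<longrightarrow>
      D U' (\<lambda>q. S q (V' q)) p - S p (D U' V' p) = covS U V p"
    by (intro allI impI) (fold covS_def, rule covS_cong[OF _ _ assms])
  show "t = covS U V p" if "\<forall>U' V'. smf U' \<longrightarrow> smf V' \<longrightarrow> U' p = U p \<longrightarrow> V' p = V p \<longrightarrow>
      D U' (\<lambda>q. S q (V' q)) p - S p (D U' V' p) = t" for t
    using that[rule_format, OF assms refl refl] by (simp add: covS_def)
qed

lemma cov_commute: "cov p u v = cov p v u"
proof -
  obtain U where U: "smf U" "U p = u" by (rule smooth_extension)
  obtain V where V: "smf V" "V p = v" by (rule smooth_extension)
  show ?thesis
    using cov_eq[OF U(1) V(1), of p] cov_eq[OF V(1) U(1), of p] codazzi[OF U(1) V(1), of p] U V by simp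
qed

lemma cov_add: "cov p (u + u') v = cov p u v + cov p u' v"
proof (rule ip_eqI[of p])
  fix w
  obtain U where U: "smf U" "U p = u" by (rule smooth_extension)
  obtain U' where U': "smf U'" "U' p = u'" by (rule smooth_extension)
  obtain V where V: "smf V" "V p = v" by (rule smooth_extension)
  have UU: "smf (\<lambda>q. U q + U' q)" by (rule smf_add[OF U(1) U'(1)])
  show "ip p (cov p (u + u') v) w = ip p (cov p u v + cov p u' v) w"
    using cov_eq[OF U(1) V(1), of p] cov_eq[OF U'(1) V(1), of p] cov_eq[OF UU V(1), of p]
      ip_covS[OF U(1) V(1), of p w] ip_covS[OF U'(1) V(1), of p w] ip_covS[OF UU V(1), of p w]
      linear_add[OF linear_mderiv[OF smooth_dF[OF V(1)]]]
      linear_add[OF linear_mderiv[OF smooth_dF[OF smf_S[OF V(1)]]]]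
    by (simp add: U V U' ip_linear inner_add_left)
qed

lemma cov_scale: "cov p (c *\<^sub>R u) v = c *\<^sub>R cov p u v"
proof (rule ip_eqI[of p])
  fix w
  obtain U where U: "smf U" "U p = u" by (rule smooth_extension)
  obtain V where V: "smf V" "V p = v" by (rule smooth_extension)
  have UU: "smf (\<lambda>q. c *\<^sub>R U q)" by (rule smf_scale[OF U(1)])
  show "ip p (cov p (c *\<^sub>R u) v) w = ip p (c *\<^sub>R cov p u v) w"
    using cov_eq[OF U(1) V(1), of p] cov_eq[OF UU V(1), of p]
      ip_covS[OF U(1) V(1), of p w] ip_covS[OF UU V(1), of p w]
      linear_cmul[OF linear_mderiv[OF smooth_dF[OF V(1)]]]
      linear_cmul[OF linear_mderiv[OF smooth_dF[OF smf_S[OF V(1)]]]]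
    by (simp add: U V ip_linear right_diff_distrib)
qed

text \<open>Differentiate \<open>ip (S V) W = ip V (S W)\<close> along \<open>U\<close>. Together
  with \<open>cov_commute\<close> this makes \<alpha> symmetric in all three arguments.\<close>

lemma cov_self_adjoint: "ip p (cov p u v) w = ip p v (cov p u w)"
proof -
  obtain U where U: "smf U" "U p = u" by (rule smooth_extension)
  obtain V where V: "smf V" "V p = v" by (rule smooth_extension)
  obtain W where W: "smf W" "W p = w" by (rule smooth_extension)
  have "ip p (D U (\<lambda>q. S q (V q)) p) w + ip p (S p v) (D U W p) =
      ip p (D U V p) (S p w) + ip p v (D U (\<lambda>q. S q (W q)) p)"
    using D_metric[OF U(1) smf_S[OF V(1)] W(1), of p] D_metric[OF U(1) V(1) smf_S[OF W(1)], of p]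
    by (simp add: S_self_adjoint V W)
  then have "ip p (covS U V p) w = ip p v (covS U W p)"
    by (simp add: covS_def ip_linear S_self_adjoint)
  then show ?thesis using cov_eq[OF U(1) V(1), of p] cov_eq[OF U(1) W(1), of p] U V W by simp
qed

section \<open>The Gauss equation\<close>

lemma second_derivative:
  assumes X: "smf X" and Y: "smf Y" and Z: "smf Z"
  shows "mderiv \<A> (\<lambda>q. mderiv \<A> (\<lambda>q. dF q (Z q)) q (Y q)) p (X p) \<bullet> dF p w =
    ip p (D X (D Y Z) p) w - ip p (S p (Y p)) (Z p) * ip p (S p (X p)) w - ip p (Y p) (Z p) * ip p (X p) w"
proof -
  have sYZ: "smooth_map \<A> (\<lambda>q. dF q (D Y Z q))" by (intro smooth_dF D_smooth Y Z)
  have s1: "smooth_map \<A> (\<lambda>q. ip q (S q (Y q)) (Z q))" "smooth_map \<A> (\<lambda>q. ip q (Y q) (Z q))"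
    unfolding induced_metric_def by (intro smooth_map_inner smooth_dF smf_S Y Z)+
  have "mderiv \<A> (\<lambda>q. mderiv \<A> (\<lambda>q. dF q (Z q)) q (Y q)) p (X p) =
     mderiv \<A> (\<lambda>q. dF q (D Y Z q) + ip q (S q (Y q)) (Z q) *\<^sub>R \<nu> q - ip q (Y q) (Z q) *\<^sub>R F q) p (X p)"
    by (simp add: gauss_formula[OF Y Z])
  also have "\<dots> = mderiv \<A> (\<lambda>q. dF q (D Y Z q)) p (X p) +
      (ip p (S p (Y p)) (Z p) *\<^sub>R mderiv \<A> \<nu> p (X p) +
       mderiv \<A> (\<lambda>q. ip q (S q (Y q)) (Z q)) p (X p) *\<^sub>R \<nu> p) -
      (ip p (Y p) (Z p) *\<^sub>R mderiv \<A> F p (X p) + mderiv \<A> (\<lambda>q. ip q (Y q) (Z q)) p (X p) *\<^sub>R F p)"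
    by (simp only: mderiv_diff[OF smooth_map_add[OF sYZ smooth_map_scaleR[OF s1(1) smooth_nu]]
          smooth_map_scaleR[OF s1(2) smooth_F]]
        mderiv_add[OF sYZ smooth_map_scaleR[OF s1(1) smooth_nu]]
        mderiv_scaleR[OF s1(1) smooth_nu] mderiv_scaleR[OF s1(2) smooth_F])
  \<comment> \<open>Pairing with a tangent vector removes the multiples of \<nu> and
    \<open>F\<close>; what survives comes from their derivatives \<open>- dF (S X)\<close> and
    \<open>dF X\<close>.\<close>
  finally show ?thesis
    using D_tangential[OF X D_smooth[OF Y Z], of p w] dF_shape[of p "X p"]
    by (simp add: inner_diff_left inner_add_left F_dF nu_dF induced_metric_def)
qed

text \<open>The left side is the curvature term \<open>R(X, Z, Z, X)\<close> written out.
  \<open>D_torsion\<close> for the map \<open>dF Z\<close> turns the derivative along the bracket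
  into commuted second derivatives. Two fields are enough, as four arguments are restored by
  polarisation in \<open>cartan_polarised\<close>.\<close>

lemma gauss_equation:
  assumes X: "smf X" and Z: "smf Z"
  shows "ip p (D X (D Z Z) p) (X p) - ip p (D Z (D X Z) p) (X p) -
      ip p (D (\<lambda>q. D X Z q - D Z X q) Z p) (X p) =
    ip p (X p) (X p) * ip p (Z p) (Z p) - (ip p (X p) (Z p))\<^sup>2 +
    ip p (S p (X p)) (X p) * ip p (S p (Z p)) (Z p) - (ip p (S p (X p)) (Z p))\<^sup>2"
proof -
  have B: "smf (\<lambda>q. D X Z q - D Z X q)" by (intro smf_diff D_smooth X Z)
  have "ip p (D (\<lambda>q. D X Z q - D Z X q) Z p) (X p) =
      mderiv \<A> (\<lambda>q. mderiv \<A> (\<lambda>q. dF q (Z q)) q (Z q)) p (X p) \<bullet> dF p (X p) -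
      mderiv \<A> (\<lambda>q. mderiv \<A> (\<lambda>q. dF q (Z q)) q (X q)) p (Z p) \<bullet> dF p (X p)"
    unfolding D_tangential[OF B Z, symmetric] D_torsion[OF smooth_dF[OF Z] X Z] inner_diff_left ..
  moreover have "ip p (S p (Z p)) (X p) = ip p (S p (X p)) (Z p)"
    unfolding S_self_adjoint[of p "Z p" "X p"] by (rule ip_commute)
  ultimately show ?thesis
    unfolding second_derivative[OF X Z Z] second_derivative[OF Z X Z] power2_eq_square
      ip_commute[of p "Z p" "X p"]
    by (simp add: algebra_simps)
qed

end


section \<open>Constant principal curvatures\<close>

text \<open>First-order condition at a maximum, for use with the Rayleigh quotient.\<close>

lemma quadratic_nonpos_linear_coeff:
  fixes b c :: real
  assumes "\<And>t. 2 * t * b + t\<^sup>2 * c \<le> 0"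
  shows "b = 0"
proof (rule ccontr)
  assume "b \<noteq> 0"
  \<comment> \<open>With this \<open>t\<close> the linear term is
    \<open>2 t^2 (\<bar>c\<bar> + 1)\<close>, which outweighs \<open>t^2 c\<close>.\<close>
  define t where "t = b / (\<bar>c\<bar> + 1)"
  have b: "b = t * (\<bar>c\<bar> + 1)" and "t \<noteq> 0" using \<open>b \<noteq> 0\<close> by (auto simp: t_def)
  have "2 * t * b + t\<^sup>2 * c = t\<^sup>2 * (2 * (\<bar>c\<bar> + 1) + c)"
    unfolding b by (simp add: power2_eq_square algebra_simps)
  moreover have "t\<^sup>2 * (2 * (\<bar>c\<bar> + 1) + c) > 0"
    using \<open>t \<noteq> 0\<close> by (intro mult_pos_pos) auto
  ultimately show False using assms[of t] by simp
qed

locale constant_curvatures = sphere_hypersurface_lc \<A> F \<nu> D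
  for \<A> :: "('p::{t2_space,second_countable_topology}, 'n::finite) chart set"
    and F \<nu> :: "'p \<Rightarrow> real^'m" and D +
  fixes K :: "real set"
  assumes K: "finite K" "{c. \<exists>u. u \<noteq> 0 \<and> shape_operator \<A> F \<nu> q u = c *\<^sub>R u} = K"
begin

lemma eigenvalue_in_K: "S q u = c *\<^sub>R u \<Longrightarrow> u \<noteq> 0 \<Longrightarrow> c \<in> K"
  using K(2)[of q] by blast

lemma eigen_orthogonal:
  assumes "S q u = a *\<^sub>R u" "S q w = b *\<^sub>R w" "a \<noteq> b"
  shows "ip q u w = 0"
  using S_self_adjoint[of q u w] assms by (simp add: ip_linear)

text \<open>A maximiser of the Rayleigh quotient on an invariant subspace is an eigenvector.\<close>

lemma eigenvector_exists:
  assumes V: "subspace V" "V \<noteq> {0}" and inv: "\<And>v. v \<in> V \<Longrightarrow> S q v \<in> V"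
  obtains u c where "u \<in> V" "u \<noteq> 0" "S q u = c *\<^sub>R u"
proof -
  define R where "R v = ip q (S q v) v / ip q v v" for v
  have cont_ip: "continuous_on T (\<lambda>v. ip q (f v) (h v))" if "linear f" "linear h"
    for T and f h :: "real^'n \<Rightarrow> real^'n"
  proof -
    have "continuous_on T (\<lambda>v. dF q (f v))" if "linear f" for f :: "real^'n \<Rightarrow> real^'n"
      using linear_continuous_on[of "dF q \<circ> f" T] linear_compose[OF that linear_dF[of q]]
      by (simp add: linear_linear comp_def)
    then show ?thesis unfolding induced_metric_def using that by (intro continuous_on_inner) auto
  qed
  \<comment> \<open>The quotient \<open>R\<close> is homogeneous of degree 0, so it may be maximised
    on the Euclidean unit sphere although it is built from \<open>ip\<close>.\<close>
  have comp: "compact (V \<inter> sphere 0 1)"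
    by (rule closed_Int_compact[OF closed_subspace[OF V(1)]]) auto
  obtain v where v: "v \<in> V" "v \<noteq> 0" using V subspace_0 by blast
  have "(1 / norm v) *\<^sub>R v \<in> V \<inter> sphere 0 1" using v V(1) by (auto simp: subspace_scale)
  then have ne: "V \<inter> sphere 0 1 \<noteq> {}" by blast
  have "continuous_on (V \<inter> sphere 0 1) R"
    unfolding R_def
  proof (rule continuous_on_divide)
    show "continuous_on (V \<inter> sphere 0 1) (\<lambda>v. ip q (S q v) v)"
      using cont_ip[OF linear_S[of q] linear_id] by (simp add: id_def)
    show "continuous_on (V \<inter> sphere 0 1) (\<lambda>v. ip q v v)"
      using cont_ip[OF linear_id linear_id] by (simp add: id_def)
    show "\<forall>v\<in>V \<inter> sphere 0 1. ip q v v \<noteq> 0"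
    proof
      fix v assume "v \<in> V \<inter> sphere 0 1"
      then have "v \<noteq> 0" by auto
      then show "ip q v v \<noteq> 0" using ip_pos[of v q] by simp
    qed
  qed
  from continuous_attains_sup[OF comp ne this] obtain u where
    u: "u \<in> V" "norm u = 1" and max: "\<And>v. v \<in> V \<inter> sphere 0 1 \<Longrightarrow> R v \<le> R u" by auto
  define c where "c = R u"
  have u0: "u \<noteq> 0" using u(2) by auto
  have le: "ip q (S q v) v \<le> c * ip q v v" if v: "v \<in> V" for v
  proof (cases "v = 0")
    case False
    let ?v = "(1 / norm v) *\<^sub>R v"
    have "?v \<in> V \<inter> sphere 0 1" using v V(1) False by (auto simp: subspace_scale)
    from max[OF this] have "R ?v \<le> c" unfolding c_def .
    moreover have "R ?v = R v" using False by (simp add: R_def ip_linear S_scale)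
    ultimately have "ip q (S q v) v / ip q v v \<le> c" by (simp only: R_def)
    then show ?thesis using ip_pos[OF False, of q] by (simp only: divide_le_eq if_True)
  qed (simp add: ip_linear S_0)
  have equ: "ip q (S q u) u = c * ip q u u"
    using ip_pos[OF u0, of q] by (simp add: c_def R_def)
  let ?r = "S q u - c *\<^sub>R u"
  have rV: "?r \<in> V" using inv[OF u(1)] V(1) u(1) by (intro subspace_diff subspace_scale)
  \<comment> \<open>Vary \<open>u\<close> in the direction of the residual \<open>?r\<close>: the
    linear coefficient of the defect in \<open>le\<close> is then
    \<open>2 * ip q ?r ?r\<close>.\<close>
  have "ip q ?r ?r = 0"
  proof (rule quadratic_nonpos_linear_coeff)
    fix t
    have "u + t *\<^sub>R ?r \<in> V" using u(1) rV V(1) by (intro subspace_add subspace_scale)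
    from le[OF this] have "ip q (S q (u + t *\<^sub>R ?r)) (u + t *\<^sub>R ?r) - c * ip q (u + t *\<^sub>R ?r) (u + t *\<^sub>R ?r) \<le> 0"
      by simp
    also have "ip q (S q (u + t *\<^sub>R ?r)) (u + t *\<^sub>R ?r) - c * ip q (u + t *\<^sub>R ?r) (u + t *\<^sub>R ?r) =
      (ip q (S q u) u - c * ip q u u) + t * (ip q (S q u) ?r + ip q (S q ?r) u - 2 * c * ip q u ?r) +
      t\<^sup>2 * (ip q (S q ?r) ?r - c * ip q ?r ?r)"
      unfolding S_add S_scale ip_linear(1,2,5,6) ip_commute[of q ?r u]
      by (simp add: power2_eq_square algebra_simps)
    also have "ip q (S q ?r) u = ip q (S q u) ?r"
      by (simp only: S_self_adjoint[of q ?r] ip_commute[of q ?r])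
    also have "ip q (S q u) ?r + ip q (S q u) ?r - 2 * c * ip q u ?r = 2 * ip q ?r ?r"
      using ip_linear(3)[of q "S q u" "c *\<^sub>R u" ?r] ip_linear(5)[of q c u ?r] by simp
    finally show "2 * t * ip q ?r ?r + t\<^sup>2 * (ip q (S q ?r) ?r - c * ip q ?r ?r) \<le> 0"
      by (simp add: equ)
  qed
  then have "?r = 0" using ip_pos[of ?r q] by (cases "?r = 0") auto
  then show ?thesis using that[OF u(1) u0, of c] by simp
qed

text \<open>The \<open>ip\<close>-orthogonal complement of all eigenvectors is invariant under
  \<open>S\<close>; if it were nonzero it would contain an eigenvector, orthogonal to
  itself.\<close>

lemma span_eigenvectors: "span {u. \<exists>c. S q u = c *\<^sub>R u} = UNIV" (is "span ?E = _")
proof (rule ccontr)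
  assume "span ?E \<noteq> UNIV"
  then have "span ?E \<subset> UNIV" by blast
  \<comment> \<open>\<open>ip\<close> is not the inner product of the type \<open>real^'n\<close>;
    the orthogonal vector is found in the image of \<open>dF\<close>, where it becomes the ambient
    one.\<close>
  then have "dF q ` span ?E \<subset> range (dF q)" 
    using inj_image_eq_iff[OF inj_dF[of q], of "span ?E" UNIV] by blast
  then have "span (dF q ` ?E) \<subset> span (range (dF q))"
    by (simp add: linear_span_image[OF linear_dF] span_UNIV)
  from orthogonal_to_subspace_exists_gen[OF this] obtain y where
    y: "y \<noteq> 0" "y \<in> span (range (dF q))" "\<And>x. x \<in> span (dF q ` ?E) \<Longrightarrow> orthogonal y x" by blast
  have "y \<in> range (dF q)" using y(2) by (simp add: linear_span_image[OF linear_dF] span_UNIV)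
  then obtain v where v: "y = dF q v" by blast
  let ?V = "{v. \<forall>u\<in>?E. ip q v u = 0}"
  have "v \<in> ?V"
    using y(3)[OF span_base] by (auto simp: v induced_metric_def orthogonal_def)
  moreover have "v \<noteq> 0" using y(1) v dF_0 by auto
  ultimately have V: "?V \<noteq> {0}" by blast
  have V': "subspace ?V" by (simp add: subspace_def ip_linear)
  have "S q v \<in> ?V" if "v \<in> ?V" for v
    using that by (auto simp: S_self_adjoint ip_linear)
  then obtain u c where u: "u \<in> ?V" "u \<noteq> 0" "S q u = c *\<^sub>R u"
    by (rule eigenvector_exists[OF V' V])
  then have "ip q u u = 0" by blast
  then show False using ip_pos[OF u(2), of q] by simp
qed

section \<open>Orthogonal decomposition into eigenspaces\<close>

definition eigen_dec :: "'p \<Rightarrow> real^'n \<Rightarrow> (real \<Rightarrow> real^'n) \<Rightarrow> bool" where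
  "eigen_dec q v f \<longleftrightarrow> v = (\<Sum>c\<in>K. f c) \<and> (\<forall>c\<in>K. S q (f c) = c *\<^sub>R f c) \<and> (\<forall>c. c \<notin> K \<longrightarrow> f c = 0)"

lemma eigen_dec_add: "eigen_dec q u f \<Longrightarrow> eigen_dec q v h \<Longrightarrow> eigen_dec q (u + v) (\<lambda>c. f c + h c)"
  by (auto simp: eigen_dec_def sum.distrib S_add scaleR_add_right)

lemma eigen_dec_scale: "eigen_dec q u f \<Longrightarrow> eigen_dec q (c *\<^sub>R u) (\<lambda>a. c *\<^sub>R f a)"
  by (auto simp: eigen_dec_def scaleR_sum_right S_scale)

lemma eigen_dec_eigen:
  assumes "S q u = a *\<^sub>R u"
  shows "eigen_dec q u (\<lambda>c. if c = a then u else 0)"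
  using eigenvalue_in_K[OF assms] assms K(1)
  by (cases "u = 0") (auto simp: eigen_dec_def S_0)

lemma eigen_dec_exists: "\<exists>f. eigen_dec q v f"
proof -
  have "v \<in> span {u. \<exists>c. S q u = c *\<^sub>R u}" by (simp add: span_eigenvectors)
  then show ?thesis
  proof (induction rule: span_induct_alt)
    case base
    then show ?case using eigen_dec_eigen[of q 0 0] S_0 by auto
  next
    case (step c x y)
    then show ?case using eigen_dec_add[OF eigen_dec_scale[OF eigen_dec_eigen]] by blast
  qed
qed

text \<open>Pairing the sum of the differences, which is zero, with its \<open>a\<close>-component
  leaves the square of that component. Off \<open>K\<close> both functions are zero by the last
  clause of \<open>eigen_dec\<close>.\<close>

lemma eigen_dec_unique:
  assumes f: "eigen_dec q v f" and h: "eigen_dec q v h"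
  shows "f = h"
proof
  fix a
  show "f a = h a"
  proof (cases "a \<in> K")
    case True
    let ?d = "\<lambda>c. f c - h c"
    have eig: "S q (?d c) = c *\<^sub>R ?d c" if "c \<in> K" for c
      using f h that by (auto simp: eigen_dec_def S_diff scaleR_diff_right)
    have "(\<Sum>c\<in>K. ?d c) = 0" using f h by (simp add: eigen_dec_def sum_subtractf)
    then have "0 = ip q (\<Sum>c\<in>K. ?d c) (?d a)" by (simp add: ip_linear)
    also have "\<dots> = (\<Sum>c\<in>K. ip q (?d c) (?d a))"
      by (rule linear_sum[of "\<lambda>v. ip q v (?d a)"]) (simp add: linear_iff ip_linear algebra_simps)
    also have "\<dots> = (\<Sum>c\<in>K. if c = a then ip q (?d a) (?d a) else 0)"
      by (rule sum.cong) (use eigen_orthogonal[OF eig eig[OF True]] in auto)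
    also have "\<dots> = ip q (?d a) (?d a)" using True K(1) by simp
    finally show ?thesis using ip_pos[of "?d a" q] by (cases "?d a = 0") auto
  qed (use f h in \<open>simp add: eigen_dec_def\<close>)
qed

definition pr :: "'p \<Rightarrow> real \<Rightarrow> real^'n \<Rightarrow> real^'n" where
  "pr q c v = (SOME f. eigen_dec q v f) c"

lemma eigen_dec_pr: "eigen_dec q v (\<lambda>c. pr q c v)"
  using someI_ex[OF eigen_dec_exists[of q v]] by (simp add: pr_def)

lemma pr_eqI: "eigen_dec q v f \<Longrightarrow> pr q c v = f c"
  using eigen_dec_unique[OF eigen_dec_pr] by metis

lemma pr_sum: "(\<Sum>c\<in>K. pr q c v) = v"
  using eigen_dec_pr[of q v] by (simp add: eigen_dec_def)

lemma S_pr: "S q (pr q c v) = c *\<^sub>R pr q c v"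
  using eigen_dec_pr[of q v] by (cases "c \<in> K") (auto simp: eigen_dec_def S_0)

lemma pr_add: "pr q c (u + v) = pr q c u + pr q c v"
  by (rule pr_eqI[OF eigen_dec_add[OF eigen_dec_pr eigen_dec_pr]])

lemma pr_scale: "pr q c (a *\<^sub>R u) = a *\<^sub>R pr q c u"
  by (rule pr_eqI[OF eigen_dec_scale[OF eigen_dec_pr]])

lemma pr_eigen: "S q u = a *\<^sub>R u \<Longrightarrow> pr q c u = (if c = a then u else 0)"
  by (rule pr_eqI[OF eigen_dec_eigen])

lemma linear_pr: "linear (pr q c)"
  by (rule linearI) (simp_all add: pr_add pr_scale)

lemma ip_sum_left: "ip q (\<Sum>i\<in>I. f i) v = (\<Sum>i\<in>I. ip q (f i) v)"
  by (rule linear_sum[of "\<lambda>u. ip q u v"]) (simp add: linear_iff ip_linear algebra_simps)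

lemma ip_pr_eigen:
  assumes "S q v = c *\<^sub>R v"
  shows "ip q (pr q c u) v = ip q u v"
proof (cases "v = 0")
  case False
  then have c: "c \<in> K" by (rule eigenvalue_in_K[OF assms])
  have "ip q u v = (\<Sum>a\<in>K. ip q (pr q a u) v)"
    by (subst pr_sum[of q u, symmetric]) (rule ip_sum_left)
  also have "\<dots> = (\<Sum>a\<in>K. if a = c then ip q (pr q c u) v else 0)"
    by (rule sum.cong) (use eigen_orthogonal[OF S_pr assms] in auto)
  also have "\<dots> = ip q (pr q c u) v" using c K(1) by simp
  finally show ?thesis by simp
qed (simp add: ip_linear)

lemma ip_pr: "ip q (pr q c u) v = ip q (pr q c u) (pr q c v)" "ip q (pr q c u) v = ip q u (pr q c v)"
proof -
  show 1: "ip q (pr q c u) v = ip q (pr q c u) (pr q c v)"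
    using ip_pr_eigen[OF S_pr[of q c u], of v] by (simp add: ip_commute)
  show "ip q (pr q c u) v = ip q u (pr q c v)"
    unfolding 1 by (rule ip_pr_eigen[OF S_pr])
qed

lemma ip_pr_sum: "ip q u v = (\<Sum>c\<in>K. ip q (pr q c u) (pr q c v))"
  by (subst pr_sum[of q u, symmetric], subst ip_sum_left, rule sum.cong[OF refl], rule ip_pr(1))

lemma pr_S: "pr q c (S q u) = c *\<^sub>R pr q c u"
proof (rule ip_eqI)
  fix w
  have "ip q (pr q c (S q u)) w = ip q u (S q (pr q c w))" by (simp add: ip_pr(2) S_self_adjoint)
  then show "ip q (pr q c (S q u)) w = ip q (c *\<^sub>R pr q c u) w"
    by (simp add: S_pr ip_linear ip_pr(2))
qed

text \<open>Eigenfields are obtained from arbitrary fields by applying a polynomial in the shape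
  operator with constant coefficients.\<close>

lemma polynomial_field:
  assumes "finite B" "smf V"
  shows "\<exists>V'. smf V' \<and> (\<forall>q. V' q = (\<Sum>c\<in>K. (\<Prod>b\<in>B. (c - b) / (a - b)) *\<^sub>R pr q c (V q)))"
  using assms(1)
proof (induction rule: finite_induct)
  case empty
  then show ?case using assms(2) by (auto simp: pr_sum)
next
  case (insert b B)
  then obtain V' where V': "smf V'" "\<And>q. V' q = (\<Sum>c\<in>K. (\<Prod>b\<in>B. (c - b) / (a - b)) *\<^sub>R pr q c (V q))"
    by blast
  let ?V = "\<lambda>q. (1 / (a - b)) *\<^sub>R (S q (V' q) - b *\<^sub>R V' q)"
  have "?V q = (\<Sum>c\<in>K. (\<Prod>b\<in>insert b B. (c - b) / (a - b)) *\<^sub>R pr q c (V q))" for q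
  proof -
    have "S q (V' q) = (\<Sum>c\<in>K. (\<Prod>b\<in>B. (c - b) / (a - b)) *\<^sub>R c *\<^sub>R pr q c (V q))"
      unfolding V'(2) by (simp only: linear_sum[OF linear_S] S_scale S_pr)
    then have "?V q = (\<Sum>c\<in>K. (1 / (a - b)) *\<^sub>R ((\<Prod>b\<in>B. (c - b) / (a - b)) *\<^sub>R c *\<^sub>R pr q c (V q) -
        b *\<^sub>R (\<Prod>b\<in>B. (c - b) / (a - b)) *\<^sub>R pr q c (V q)))"
      by (simp only: V'(2)[of q] scaleR_sum_right[of b] sum_subtractf[symmetric] scaleR_sum_right[of "1 / (a - b)"])
    also have "\<dots> = (\<Sum>c\<in>K. (\<Prod>b\<in>insert b B. (c - b) / (a - b)) *\<^sub>R pr q c (V q))"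
      by (rule sum.cong[OF refl])
        (simp add: prod.insert[OF insert.hyps] algebra_simps diff_divide_distrib)
    finally show ?thesis .
  qed
  moreover have "smf ?V" by (intro smf_scale smf_diff smf_S V'(1))
  ultimately show ?case by blast
qed

text \<open>The Lagrange polynomial with value 1 at \<open>a\<close> and 0 on
  \<open>K - {a}\<close>, evaluated at \<open>S\<close>, is the projection \<open>pr r a\<close> at
  every point \<open>r\<close>; it is applied to an arbitrary extension.\<close>

lemma eigenfield_extension:
  assumes u: "S q u = a *\<^sub>R u"
  obtains U where "smf U" "U q = u" "\<And>r. S r (U r) = a *\<^sub>R U r"
proof -
  obtain V where V: "smf V" "V q = u" by (rule smooth_extension)
  obtain U where U: "smf U" "\<And>r. U r = (\<Sum>c\<in>K. (\<Prod>b\<in>K - {a}. (c - b) / (a - b)) *\<^sub>R pr r c (V r))"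
    using polynomial_field[OF finite_Diff[OF K(1), of "{a}"] V(1), of a] by blast
  have "(\<Prod>b\<in>K - {a}. (c - b) / (a - b)) = (if c = a then 1 else 0)" if "c \<in> K" for c
    using that K(1) by (auto intro: prod.neutral)
  then have "U r = (\<Sum>c\<in>K. if c = a then pr r a (V r) else 0)" for r
    unfolding U(2) by (intro sum.cong) auto
  then have Ur: "U r = pr r a (V r)" for r
    using K(1) eigen_dec_pr[of r "V r"] by (auto simp: eigen_dec_def)
  show ?thesis
    by (rule that[OF U(1)]) (simp_all add: Ur V(2) pr_eigen[OF u] S_pr)
qed

section \<open>Derivatives of eigenfields and Cartan's identity\<close>

lemma D_scale:
  assumes "smf X" "smf Y"
  shows "D X (\<lambda>q. c *\<^sub>R Y q) p = c *\<^sub>R D X Y p"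
proof (rule ip_eqI[of p])
  fix w
  have "mderiv \<A> (\<lambda>q. dF q (c *\<^sub>R Y q)) p (X p) = c *\<^sub>R mderiv \<A> (\<lambda>q. dF q (Y q)) p (X p)"
    unfolding dF_scale by (rule mderiv_bounded_linear[OF bounded_linear_scaleR_right smooth_dF[OF assms(2)]])
  then show "ip p (D X (\<lambda>q. c *\<^sub>R Y q) p) w = ip p (c *\<^sub>R D X Y p) w"
    using D_tangential[OF assms, of p w] D_tangential[OF assms(1) smf_scale[OF assms(2)], of c p w]
    by (simp add: ip_linear)
qed

lemma covS_eigenfield:
  assumes "smf W" "smf U" "\<And>q. S q (U q) = a *\<^sub>R U q"
  shows "covS W U p = a *\<^sub>R D W U p - S p (D W U p)"
  unfolding covS_def assms(3) D_scale[OF assms(1,2)] ..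

text \<open>As \<open>a\<close> is constant, \<open>cov p w u\<close> is \<open>(a - S)\<close>
  applied to \<open>D W U\<close>, and the image of \<open>a - S\<close> is orthogonal to the
  eigenspace of \<open>a\<close>.\<close>

lemma ip_cov_same_eigen:
  assumes u: "S p u = a *\<^sub>R u" and x: "S p x = a *\<^sub>R x"
  shows "ip p (cov p w u) x = 0"
proof -
  obtain W where W: "smf W" "W p = w" by (rule smooth_extension)
  obtain U where U: "smf U" "U p = u" "\<And>r. S r (U r) = a *\<^sub>R U r" by (rule eigenfield_extension[OF u]) blast
  have "cov p w u = a *\<^sub>R D W U p - S p (D W U p)"
    using cov_eq[OF W(1) U(1), of p] covS_eigenfield[OF W(1) U(1,3)] W(2) U(2) by simp
  then show ?thesis by (simp add: ip_linear S_self_adjoint x)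
qed

lemma pr_cov_eigen:
  assumes "S p u = a *\<^sub>R u"
  shows "pr p a (cov p w u) = 0" "pr p a (cov p u w) = 0"
proof -
  show "pr p a (cov p w u) = 0"
    by (rule ip_eqI[of p]) (simp add: ip_pr(2) ip_cov_same_eigen[OF assms S_pr] ip_linear)
  then show "pr p a (cov p u w) = 0" by (simp add: cov_commute)
qed

text \<open>Cartan's identity: the Gauss equation for eigenfields \<open>X\<close>, \<open>Z\<close>, whose covariant
  derivatives are determined by \<open>cov\<close> up to components along their own eigenspace.\<close>

lemma cartan_identity:
  assumes u: "S p u = a *\<^sub>R u" and w: "S p w = c *\<^sub>R w" and "a \<noteq> c"
  shows "(1 + a * c) * ip p u u * ip p w w =
    2 * (\<Sum>m\<in>K. ip p (pr p m (cov p u w)) (pr p m (cov p u w)) / ((m - a) * (m - c)))"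
proof -
  obtain X where X: "smf X" "X p = u" "\<And>r. S r (X r) = a *\<^sub>R X r" by (rule eigenfield_extension[OF u]) blast
  obtain Z where Z: "smf Z" "Z p = w" "\<And>r. S r (Z r) = c *\<^sub>R Z r" by (rule eigenfield_extension[OF w]) blast
  let ?N = "cov p u w" and ?M1 = "D X Z p" and ?M2 = "D Z X p"
  have N1: "?N = c *\<^sub>R ?M1 - S p ?M1"
    using cov_eq[OF X(1) Z(1), of p] covS_eigenfield[OF X(1) Z(1,3)] X(2) Z(2) by simp
  have N2: "?N = a *\<^sub>R ?M2 - S p ?M2"
    using cov_eq[OF Z(1) X(1), of p] covS_eigenfield[OF Z(1) X(1,3)] X(2) Z(2)
      cov_commute[of p u w] by simp
  \<comment> \<open>Symmetry moves the arbitrary vector \<open>v\<close> into the direction slot,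
    leaving two eigenvectors of \<open>b\<close>; thus \<open>cov\<close> vanishes on
    \<open>U\<close>, \<open>U\<close>.\<close>
  have DUU: "S q (D U U q) = b *\<^sub>R D U U q" if U: "smf U" "\<And>r. S r (U r) = b *\<^sub>R U r" for U b q
  proof -
    have "cov q (U q) (U q) = 0"
    proof (rule ip_eqI[of q])
      fix v
      have "ip q (cov q (U q) (U q)) v = ip q (cov q v (U q)) (U q)"
        unfolding cov_self_adjoint[of q "U q" "U q"] cov_commute[of q "U q" v] by (rule ip_commute)
      then show "ip q (cov q (U q) (U q)) v = ip q 0 v"
        unfolding ip_cov_same_eigen[OF U(2) U(2)] ip_linear .
    qed
    then show ?thesis using cov_eq[OF U(1) U(1), of q] covS_eigenfield[OF U(1) U, of q] by simp
  qed
  have XZ: "ip q (X q) (Z q) = 0" for q by (rule eigen_orthogonal[OF X(3) Z(3) \<open>a \<noteq> c\<close>])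
  have e1: "ip q (D Z Z q) (X q) = 0" for q
    using eigen_orthogonal[OF DUU[OF Z(1,3)] X(3)] \<open>a \<noteq> c\<close> by auto
  have e2: "ip q (D X Z q) (X q) = 0" for q
  proof -
    have "ip q (covS X Z q) (X q) = 0"
      using ip_cov_same_eigen[OF X(3) X(3), of q "Z q"] cov_eq[OF X(1) Z(1), of q]
        cov_commute[of q "X q" "Z q"] by simp
    then have "(c - a) * ip q (D X Z q) (X q) = 0"
      unfolding covS_eigenfield[OF X(1) Z(1,3)]
      by (simp add: ip_linear S_self_adjoint X(3) left_diff_distrib)
    then show ?thesis using \<open>a \<noteq> c\<close> by simp
  qed
  \<comment> \<open>\<open>e1\<close> and \<open>e2\<close> hold at every point, so their
    derivatives vanish; this trades second-order terms for products of first derivatives.\<close>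
  have g1: "ip p (D X (D Z Z) p) u = 0"
    using D_metric[OF X(1) D_smooth[OF Z(1) Z(1)] X(1), of p]
      eigen_orthogonal[OF DUU[OF Z(1,3)] DUU[OF X(1,3)], of p] \<open>a \<noteq> c\<close>
    by (simp add: e1 mderiv_const X(2))
  have g2: "ip p (D Z (D X Z) p) u = - ip p ?M1 ?M2"
    using D_metric[OF Z(1) D_smooth[OF X(1) Z(1)] X(1), of p]
    by (simp add: e2 mderiv_const X(2))
  let ?B = "\<lambda>q. D X Z q - D Z X q"
  have sB: "smf ?B" by (intro smf_diff D_smooth X Z)
  \<comment> \<open>The derivative along the bracket is not known directly; paired with the
    eigenvector \<open>u\<close> it equals a value of \<open>cov\<close> up to the factor
    \<open>c - a\<close>.\<close>
  have "(c - a) * ip p (D ?B Z p) u = ip p (cov p (?M1 - ?M2) w) u"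
    using cov_eq[OF sB Z(1), of p] covS_eigenfield[OF sB Z(1,3), of p] Z(2)
    by (simp add: ip_linear S_self_adjoint u left_diff_distrib)
  also have "\<dots> = ip p (?M1 - ?M2) ?N"
    by (simp only: cov_commute[of p "?M1 - ?M2" w] cov_self_adjoint[of p w "?M1 - ?M2" u]
        cov_commute[of p w u])
  also have "\<dots> = (a - c) * ip p ?M1 ?M2"
  proof -
    have "ip p ?M1 ?N = a * ip p ?M1 ?M2 - ip p (S p ?M1) ?M2"
      by (subst N2) (simp add: ip_linear S_self_adjoint)
    moreover have "ip p ?M2 ?N = c * ip p ?M1 ?M2 - ip p (S p ?M1) ?M2"
      by (subst N1) (simp add: ip_linear ip_commute[of p ?M2 ?M1] ip_commute[of p ?M2 "S p ?M1"])
    ultimately show ?thesis by (simp add: ip_linear left_diff_distrib)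
  qed
  finally have "(c - a) * (ip p (D ?B Z p) u + ip p ?M1 ?M2) = 0" by (simp add: algebra_simps)
  then have g3: "ip p (D ?B Z p) u = - ip p ?M1 ?M2" using \<open>a \<noteq> c\<close> by simp
  have "(1 + a * c) * ip p u u * ip p w w = 2 * ip p ?M1 ?M2"
    using gauss_equation[OF X(1) Z(1), of p] XZ[of p]
    by (simp add: X(2) Z(2) g1 g2 g3 u w ip_linear algebra_simps)
  also have "ip p ?M1 ?M2 = (\<Sum>m\<in>K. ip p (pr p m ?N) (pr p m ?N) / ((m - a) * (m - c)))"
    unfolding ip_pr_sum[of p ?M1]
  proof (rule sum.cong[OF refl])
    fix m
    have p1: "pr p m ?N = (c - m) *\<^sub>R pr p m ?M1"
      unfolding N1 by (simp add: linear_diff[OF linear_pr] pr_scale pr_S scaleR_diff_left)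
    have p2: "pr p m ?N = (a - m) *\<^sub>R pr p m ?M2"
      unfolding N2 by (simp add: linear_diff[OF linear_pr] pr_scale pr_S scaleR_diff_left)
    \<comment> \<open>For \<open>m = a\<close> or \<open>m = c\<close> the
      \<open>m\<close>-component of \<open>?N\<close> is zero, which forces that of
      \<open>?M1\<close> or \<open>?M2\<close> to vanish, so both sides are 0.\<close>
    consider "m = a" | "m = c" | "m \<noteq> a" "m \<noteq> c" by blast
    then show "ip p (pr p m ?M1) (pr p m ?M2) = ip p (pr p m ?N) (pr p m ?N) / ((m - a) * (m - c))"
    proof cases
      case 1
      then have "pr p m ?M1 = 0" using p1 pr_cov_eigen(2)[OF u, of w] \<open>a \<noteq> c\<close> by simp
      then show ?thesis using 1 by (simp add: ip_linear)
    next
      case 2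
      then have "pr p m ?M2 = 0" using p2 pr_cov_eigen(1)[OF w, of u] \<open>a \<noteq> c\<close> by simp
      then show ?thesis using 2 by (simp add: ip_linear)
    next
      case 3
      have "ip p (pr p m ?N) (pr p m ?N) = (m - a) * (m - c) * ip p (pr p m ?M1) (pr p m ?M2)"
        by (subst p1, subst p2) (simp add: ip_linear algebra_simps)
      then show ?thesis using 3 by simp
    qed
  qed
  finally show ?thesis .
qed

lemma cov_add_right: "cov p u (v + v') = cov p u v + cov p u v'"
  unfolding cov_commute[of p u] by (rule cov_add)

lemma cov_scale_right: "cov p u (c *\<^sub>R v) = c *\<^sub>R cov p u v"
  unfolding cov_commute[of p u] by (rule cov_scale)

text \<open>The defect \<open>G\<close> is additive in each argument and symmetric in
  \<open>x\<close>, \<open>y\<close> and in \<open>z\<close>, \<open>w\<close>. It vanishes on the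
  diagonal by \<open>cartan_identity\<close>, hence everywhere on these eigenspaces after polarising
  in each pair.\<close>

lemma cartan_polarised:
  assumes x: "S p x = a *\<^sub>R x" and y: "S p y = a *\<^sub>R y"
    and z: "S p z = c *\<^sub>R z" and w: "S p w = c *\<^sub>R w" and "a \<noteq> c"
  shows "(1 + a * c) * ip p x y * ip p z w = (\<Sum>m\<in>K.
    (ip p (pr p m (cov p y w)) (cov p x z) + ip p (pr p m (cov p y z)) (cov p x w)) / ((m - a) * (m - c)))"
proof -
  define H where "H x y z w m = ip p (pr p m (cov p y w)) (cov p x z) +
    ip p (pr p m (cov p y z)) (cov p x w)" for x y z w m
  define G where "G x y z w = (\<Sum>m\<in>K. H x y z w m / ((m - a) * (m - c))) -
    (1 + a * c) * ip p x y * ip p z w" for x y z w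
  have add1: "G (x + x') y z w = G x y z w + G x' y z w" for x x' y z w
  proof -
    have "H (x + x') y z w m = H x y z w m + H x' y z w m" for m
      by (simp add: H_def cov_add pr_add ip_linear)
    then show ?thesis
      by (simp add: G_def add_divide_distrib sum.distrib ip_linear algebra_simps)
  qed
  have add3: "G x y (z + z') w = G x y z w + G x y z' w" for x y z z' w
  proof -
    have "H x y (z + z') w m = H x y z w m + H x y z' w m" for m
      by (simp add: H_def cov_add_right pr_add ip_linear)
    then show ?thesis
      by (simp add: G_def add_divide_distrib sum.distrib ip_linear algebra_simps)
  qed
  have sym1: "G x y z w = G y x z w" for x y z w
  proof -
    have "H x y z w m = H y x z w m" for m
      unfolding H_def by (simp add: ip_pr(2) ip_commute[of p "cov p y _"])
    then show ?thesis by (simp add: G_def ip_commute[of p x y])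
  qed
  have sym3: "G x y z w = G x y w z" for x y z w
  proof -
    have "H x y z w m = H x y w z m" for m unfolding H_def by simp
    then show ?thesis by (simp add: G_def ip_commute[of p z w])
  qed
  have diag: "G x x z z = 0" if "S p x = a *\<^sub>R x" "S p z = c *\<^sub>R z" for x z
  proof -
    have "H x x z z m = 2 * ip p (pr p m (cov p x z)) (pr p m (cov p x z))" for m
      by (simp add: H_def ip_pr(1)[symmetric])
    then show ?thesis
      by (simp add: G_def cartan_identity[OF that \<open>a \<noteq> c\<close>] sum_distrib_left)
  qed
  have add2: "G x (y + y') z w = G x y z w + G x y' z w" for x y y' z w
    unfolding sym1[of x] by (rule add1)
  have add4: "G x y z (w + w') = G x y z w + G x y z w'" for x y z w w'
    unfolding sym3[of x y z] by (rule add3)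
  have semi: "G x y z z = 0" if "S p z = c *\<^sub>R z" for z
    using diag[OF _ that, of "x + y"] diag[OF x that] diag[OF y that] x y sym1[of x y]
    by (simp add: S_add scaleR_add_right add1 add2)
  have "G x y z w = 0"
    using semi[of "z + w"] semi[OF z] semi[OF w] z w sym3[of x y z w]
    by (simp add: S_add scaleR_add_right add3 add4)
  then show ?thesis by (simp add: G_def H_def)
qed

end


section \<open>Complexification and the Cayley transform\<close>

lemma cvec_add: "cvec (u + v) = cvec u + cvec v"
  by (simp add: cvec_def vec_eq_iff)

lemma cvec_scaleR: "cvec (c *\<^sub>R u) = of_real c *s cvec u"
  by (simp add: cvec_def vec_eq_iff)

lemma cvec_sum: "cvec (\<Sum>i\<in>I. f i) = (\<Sum>i\<in>I. cvec (f i))"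
  by (simp add: cvec_def vec_eq_iff)

lemma linear_functional_expansion:
  fixes f :: "real^'n \<Rightarrow> real"
  assumes "linear f"
  shows "f u = (\<Sum>a\<in>UNIV. u $ a * f (axis a 1))"
proof -
  have "f (\<Sum>a\<in>UNIV. u $ a *s axis a 1) = (\<Sum>a\<in>UNIV. u $ a * f (axis a 1))"
    by (simp add: linear_sum[OF assms] linear_cmul[OF assms] scalar_mult_eq_scaleR)
  then show ?thesis by (simp add: basis_expansion)
qed

lemma clinear_ext_add: "clinear_ext L (x + y) = clinear_ext L x + clinear_ext L y"
  by (simp add: clinear_ext_def vec_eq_iff sum.distrib algebra_simps)

lemma clinear_ext_scale: "clinear_ext L (c *s x) = c *s clinear_ext L x"
  by (simp add: clinear_ext_def vec_eq_iff sum_distrib_left mult.assoc)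

lemma clinear_ext_cvec:
  assumes "linear L"
  shows "clinear_ext L (cvec u) = cvec (L u)"
proof (rule vec_eq_iff[THEN iffD2], rule allI)
  fix i
  have "linear (\<lambda>v. L v $ i)"
    using linear_compose[OF assms bounded_linear.linear[OF bounded_linear_vec_nth, of i]] by (simp add: comp_def)
  from linear_functional_expansion[OF this, of u]
  show "clinear_ext L (cvec u) $ i = cvec (L u) $ i"
    by (simp add: clinear_ext_def cvec_def flip: of_real_mult of_real_sum)
qed

lemma cbilinear_ext_scale: "cbilinear_ext b (c *s x) y = c * cbilinear_ext b x y"
  by (simp add: cbilinear_ext_def sum_distrib_left mult.assoc)

lemma cbilinear_ext_cvec:
  assumes "\<And>v. linear (\<lambda>u. b u v)" "\<And>u. linear (b u)"
  shows "cbilinear_ext b (cvec u) (cvec v) = of_real (b u v)"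
proof -
  have "b u v = (\<Sum>a\<in>UNIV. u $ a * (\<Sum>c\<in>UNIV. v $ c * b (axis a 1) (axis c 1)))"
    by (subst linear_functional_expansion[OF assms(1)], subst linear_functional_expansion[OF assms(2)]) simp
  then show ?thesis
    by (simp add: cbilinear_ext_def cvec_def sum_distrib_left mult.assoc)
qed

lemma cbilinear_ext_add:
  "cbilinear_ext b (x + x') y = cbilinear_ext b x y + cbilinear_ext b x' y"
  "cbilinear_ext b x (y + y') = cbilinear_ext b x y + cbilinear_ext b x y'"
  by (simp_all add: cbilinear_ext_def sum.distrib algebra_simps)

lemma ctrilinear_ext_add:
  "ctrilinear_ext t (x + x') y z = ctrilinear_ext t x y z + ctrilinear_ext t x' y z"
  "ctrilinear_ext t x (y + y') z = ctrilinear_ext t x y z + ctrilinear_ext t x y' z"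
  "ctrilinear_ext t x y (z + z') = ctrilinear_ext t x y z + ctrilinear_ext t x y z'"
  by (simp_all add: ctrilinear_ext_def sum.distrib algebra_simps)

lemma ctrilinear_ext_0: "ctrilinear_ext t x y 0 = 0"
  by (simp add: ctrilinear_ext_def)

lemma ctrilinear_ext_scale:
  "ctrilinear_ext t (c *s x) y z = c * ctrilinear_ext t x y z"
  "ctrilinear_ext t x (c *s y) z = c * ctrilinear_ext t x y z"
  "ctrilinear_ext t x y (c *s z) = c * ctrilinear_ext t x y z"
  by (simp_all add: ctrilinear_ext_def sum_distrib_left mult_ac)

lemma ctrilinear_ext_sum:
  "ctrilinear_ext t x y (\<Sum>i\<in>I. f i) = (\<Sum>i\<in>I. ctrilinear_ext t x y (f i))"
  by (induction I rule: infinite_finite_induct) (simp_all add: ctrilinear_ext_0 ctrilinear_ext_add)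

lemma ctrilinear_ext_cvec:
  assumes "\<And>v w. linear (\<lambda>u. t u v w)" "\<And>u w. linear (\<lambda>v. t u v w)" "\<And>u v. linear (t u v)"
  shows "ctrilinear_ext t (cvec u) (cvec v) (cvec w) = of_real (t u v w)"
proof -
  have "t u v w = (\<Sum>a\<in>UNIV. u $ a * (\<Sum>b\<in>UNIV. v $ b * (\<Sum>c\<in>UNIV. w $ c * t (axis a 1) (axis b 1) (axis c 1))))"
    by (subst linear_functional_expansion[OF assms(1)], subst linear_functional_expansion[OF assms(2)],
      subst linear_functional_expansion[OF assms(3)]) simp
  then show ?thesis
    by (simp add: ctrilinear_ext_def cvec_def sum_distrib_left mult.assoc)
qed

section \<open>The Cayley transform and roots of unity\<close>

definition cayley :: "real \<Rightarrow> complex" where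
  "cayley t = (of_real t + \<i>) / (of_real t - \<i>)"

lemma of_real_pm_i_nonzero: "of_real t + \<i> \<noteq> 0" "of_real t - \<i> \<noteq> 0"
proof -
  have "Im (of_real t + \<i>) \<noteq> 0" "Im (of_real t - \<i>) \<noteq> 0" by simp_all
  then show "of_real t + \<i> \<noteq> 0" "of_real t - \<i> \<noteq> 0" by (metis zero_complex.sel(2))+
qed

lemma cayley_nonzero: "cayley t \<noteq> 0"
  using of_real_pm_i_nonzero[of t] by (simp only: cayley_def divide_eq_0_iff simp_thms)

lemma cayley_add: "cayley c + cayley m = 2 * (1 + of_real c * of_real m) / ((of_real c - \<i>) * (of_real m - \<i>))"
  unfolding cayley_def add_frac_eq[OF of_real_pm_i_nonzero(2) of_real_pm_i_nonzero(2)]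
  by (simp add: algebra_simps)

lemma cayley_diff: "cayley c - cayley m = 2 * \<i> * (of_real m - of_real c) / ((of_real c - \<i>) * (of_real m - \<i>))"
  unfolding cayley_def diff_frac_eq[OF of_real_pm_i_nonzero(2) of_real_pm_i_nonzero(2)]
  by (simp add: algebra_simps)

lemma cayley_eq_iff: "cayley c = cayley m \<longleftrightarrow> c = m"
proof
  assume "cayley c = cayley m"
  then have "2 * \<i> * (of_real m - of_real c) / ((of_real c - \<i>) * (of_real m - \<i>)) = 0"
    unfolding cayley_diff[symmetric] by simp
  then show "c = m"
    using of_real_pm_i_nonzero(2)[of c] of_real_pm_i_nonzero(2)[of m]
    by (simp only: divide_eq_0_iff mult_eq_0_iff) simp
qed simp

text \<open>For \<open>c = cot s\<close> and \<open>m = cot t\<close> the value is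
  \<open>- \<i> cot (s - t)\<close>: the Cayley transforms are \<open>cis (2 s)\<close> and
  \<open>cis (2 t)\<close>.\<close>

lemma cayley_quotient:
  assumes "c \<noteq> m"
  shows "(cayley c + cayley m) / (cayley c - cayley m) = - \<i> * of_real ((1 + c * m) / (m - c))"
proof -
  let ?P = "(of_real c - \<i>) * (of_real m - \<i>)"
  let ?d = "complex_of_real m - of_real c"
  have "?P \<noteq> 0" using of_real_pm_i_nonzero(2) by (simp only: mult_eq_0_iff simp_thms)
  moreover have "(x / q) / (y / q) = x / y" if "q \<noteq> 0" for x y q :: complex
    using that by simp
  ultimately have cancel: "(x / ?P) / (y / ?P) = x / y" for x y by blast
  have d: "?d \<noteq> 0" using assms by simp
  have "2 * s / (2 * \<i> * d) = - \<i> * (s / d)" if "d \<noteq> 0" for s d :: complex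
    using that by (simp add: divide_eq_eq mult.left_commute[of \<i> s])
  from this[OF d, of "1 + of_real c * of_real m"]
  have "2 * (1 + complex_of_real c * of_real m) / (2 * \<i> * ?d) = - \<i> * ((1 + of_real c * of_real m) / ?d)" .
  then show ?thesis
    unfolding cayley_add cayley_diff cancel by simp
qed

text \<open>Since \<open>1 + t^2 = (t + \<i>) (t - \<i>)\<close>, the multiplier clears all
  denominators and leaves the square of \<open>(a + \<i>) (c - \<i>)\<close>. It is four times the
  product of the weights of \<open>ghat\<close> on the two eigenspaces.\<close>

lemma Im_cayley_quotient:
  "Im (cayley a * inverse (cayley c)) * ((1 + a\<^sup>2) * (1 + c\<^sup>2)) = 2 * (1 + a * c) * (c - a)"
proof -
  have 1: "of_real (1 + t\<^sup>2) = (of_real t + \<i>) * (of_real t - \<i>)" for t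
    by (simp add: algebra_simps power2_eq_square)
  have frac: "p / q * inverse (r / s) * ((p * q) * (r * s)) = (p * s)\<^sup>2" if "q \<noteq> 0" "r \<noteq> 0" for p q r s :: complex
    using that by (simp add: power2_eq_square)
  have "cayley a * inverse (cayley c) * of_real ((1 + a\<^sup>2) * (1 + c\<^sup>2)) = ((of_real a + \<i>) * (of_real c - \<i>))\<^sup>2"
    unfolding cayley_def of_real_mult 1 by (rule frac) (rule of_real_pm_i_nonzero)+
  then have "Im (cayley a * inverse (cayley c) * of_real ((1 + a\<^sup>2) * (1 + c\<^sup>2))) =
      Im (((of_real a + \<i>) * (of_real c - \<i>))\<^sup>2)" by (simp only:)
  also have "\<dots> = 2 * (1 + a * c) * (c - a)" by (simp add: power2_eq_square algebra_simps)
  also have "Im (cayley a * inverse (cayley c) * of_real ((1 + a\<^sup>2) * (1 + c\<^sup>2))) =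
      Im (cayley a * inverse (cayley c)) * ((1 + a\<^sup>2) * (1 + c\<^sup>2))"
    by (simp only: times_complex.sel Re_complex_of_real Im_complex_of_real)
  finally show ?thesis .
qed

lemma sum_root_of_unity_powers:
  fixes r :: complex
  assumes "r ^ g = 1"
  shows "(\<Sum>l<g. r ^ l) = (if r = 1 then of_nat g else 0)"
  using assms by (simp add: sum_gp_strict)

text \<open>\<open>cayley (cot t) = cis (2 * t)\<close>, and the normalisation makes
  \<open>2 g t\<close> an odd multiple of \<open>pi\<close>.\<close>

lemma cayley_cot_power:
  assumes "g > 0" "j \<in> {1..g}"
  shows "cayley (cot ((2 * real j - 1) * (pi / (2 * real g)))) ^ g = -1"
proof -
  define t where "t = (2 * real j - 1) * (pi / (2 * real g))"
  have "0 < t" using assms by (simp add: t_def)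
  moreover have "t < pi"
  proof -
    have "(2 * real j - 1) * pi < 2 * real g * pi" using assms by (intro mult_strict_right_mono) auto
    then show ?thesis using assms(1) by (simp add: t_def field_simps)
  qed
  ultimately have s: "sin t \<noteq> 0" using sin_gt_zero by force
  have "cayley (cot t) = (of_real (cos t) + \<i> * of_real (sin t)) / (of_real (cos t) - \<i> * of_real (sin t))"
    using s by (simp add: cayley_def cot_def divide_simps)
  also have "\<dots> = cis t / cis (- t)" by (simp add: cis_conv_exp[symmetric] complex_eq_iff cis.ctr Complex_eq)
  also have "\<dots> = cis (2 * t)" by (simp add: cis_divide)
  finally have "cayley (cot t) ^ g = cis (real g * (2 * t))" by (simp only: Complex.DeMoivre)
  \<comment> \<open>The natural subtraction \<open>2 * j - 1\<close> is exact because
    \<open>j \<ge> 1\<close>.\<close>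
  also have "real g * (2 * t) = real (2 * j - 1) * pi" using assms by (simp add: t_def of_nat_diff)
  also have "cis (real (2 * j - 1) * pi) = cis pi ^ (2 * j - 1)" by (simp only: Complex.DeMoivre)
  also have "\<dots> = -1" using assms by (simp add: cis_pi neg_one_odd_power)
  finally show ?thesis by (simp add: t_def)
qed

text \<open>The two summands for \<open>k\<close> share a factor, leaving the standard sum for a
  difference of \<open>j\<close>-th powers. In the sum over \<open>j\<close>, quotients of
  \<open>g\<close>-th roots of -1 are \<open>g\<close>-th roots of 1, so only \<open>c = d\<close>
  contributes and the part with \<open>m\<close> cancels out.\<close>

lemma double_geometric_sum:
  assumes g: "cayley c ^ g = -1" "cayley d ^ g = -1" "cayley m ^ g = -1" and "c \<noteq> m" "d \<noteq> m"
  shows "(\<Sum>j<g. cayley d powi (- int j) * (\<Sum>k<j. cayley c powi (int k + 1) * cayley m powi (int j - int k - 1) +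
      cayley c powi int k * cayley m powi (int j - int k))) =
    (if c = d then of_nat g else 0) * (- \<i> * of_real ((1 + c * m) / (m - c)))"
proof -
  let ?q = "(cayley c + cayley m) / (cayley c - cayley m)"
  have ne: "cayley c - cayley m \<noteq> 0" using assms(4) by (simp add: cayley_eq_iff)
  have inner: "(\<Sum>k<j. cayley c powi (int k + 1) * cayley m powi (int j - int k - 1) +
      cayley c powi int k * cayley m powi (int j - int k)) = ?q * (cayley c ^ j - cayley m ^ j)" for j
  proof -
    have pw: "p ^ Suc k * q ^ n + p ^ k * q ^ Suc n = (p + q) * (q ^ n * p ^ k)" for p q :: complex and k n
      by (simp add: algebra_simps)
    have "cayley c powi (int k + 1) * cayley m powi (int j - int k - 1) + cayley c powi int k * cayley m powi (int j - int k) =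
        (cayley c + cayley m) * (cayley m ^ (j - Suc k) * cayley c ^ k)" if "k < j" for k
    proof -
      have e: "int j - int k - 1 = int (j - Suc k)" "int j - int k = int (Suc (j - Suc k))" "int k + 1 = int (Suc k)"
        using that by auto
      show ?thesis unfolding e(1) unfolding e(2,3) power_int_of_nat by (rule pw)
    qed
    then have "(\<Sum>k<j. cayley c powi (int k + 1) * cayley m powi (int j - int k - 1) +
      cayley c powi int k * cayley m powi (int j - int k)) = (\<Sum>k<j. (cayley c + cayley m) * (cayley m ^ (j - Suc k) * cayley c ^ k))"
      by (intro sum.cong refl) blast
    also have "\<dots> = (cayley c + cayley m) * (\<Sum>k<j. cayley m ^ (j - Suc k) * cayley c ^ k)"
      by (rule sum_distrib_left[symmetric])
    also have "\<dots> = ?q * (cayley c ^ j - cayley m ^ j)"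
      unfolding power_diff_sumr2 using ne by simp
    finally show ?thesis .
  qed
  have geo: "(\<Sum>j<g. cayley d powi (- int j) * cayley t ^ j) = (if t = d then of_nat g else 0)"
    if "cayley t ^ g = -1" for t
  proof -
    have "cayley d powi (- int j) * cayley t ^ j = (cayley t / cayley d) ^ j" for j
      by (simp add: power_int_minus power_divide divide_inverse mult.commute power_inverse power_mult_distrib)
    moreover have "(cayley t / cayley d) ^ g = 1" using that g(2) by (simp add: power_divide)
    ultimately show ?thesis
      using sum_root_of_unity_powers[of "cayley t / cayley d" g] by (simp add: cayley_nonzero cayley_eq_iff)
  qed
  have distr: "p * (q * (s - t)) = q * (p * s - p * t)" for p q s t :: complex
    by (simp add: algebra_simps)
  have "(\<Sum>j<g. cayley d powi (- int j) * (?q * (cayley c ^ j - cayley m ^ j))) =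
      ?q * ((\<Sum>j<g. cayley d powi (- int j) * cayley c ^ j) - (\<Sum>j<g. cayley d powi (- int j) * cayley m ^ j))"
    unfolding sum_subtractf[symmetric] sum_distrib_left distr ..
  also have "\<dots> = ?q * (if c = d then of_nat g else 0)"
    using geo[OF g(1)] geo[OF g(3)] assms(5) by simp
  finally show ?thesis unfolding inner cayley_quotient[OF assms(4)] by (simp add: mult.commute)
qed


section \<open>The curvature identity\<close>

lemma scaleR_conv_vector_smult: "c *\<^sub>R x = complex_of_real c *s x" for x :: "complex^'n"
  by (simp only: vec_eq_iff vector_scaleR_component vector_smult_component) (simp add: scaleR_conv_of_real)

lemma cvec_Re_Im:
  fixes x :: "complex^'n"
  obtains u v where "x = cvec u + \<i> *s cvec v"
proof
  show "x = cvec (\<chi> i. Re (x $ i)) + \<i> *s cvec (\<chi> i. Im (x $ i))"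
    by (simp add: vec_eq_iff cvec_def complex_eq_iff)
qed

lemma cvec_combination_eq_0_iff: "cvec u + \<i> *s cvec v = 0 \<longleftrightarrow> u = 0 \<and> v = 0"
  by (auto simp: vec_eq_iff cvec_def complex_eq_iff)

text \<open>Reduces one slot of an additive identity to eigenvectors; it is applied to the four
  slots in turn.\<close>

lemma additive_eigen_induct:
  fixes f h :: "real^'n \<Rightarrow> complex"
  assumes "\<And>u v. f (u + v) = f u + f v" "\<And>u v. h (u + v) = h u + h v"
    and "\<And>c. c \<in> K \<Longrightarrow> f (P c) = h (P c)" and "finite K" "x = (\<Sum>c\<in>K. P c)"
  shows "f x = h x"
proof -
  have 0: "f 0 = 0" "h 0 = 0" using assms(1)[of 0 0] assms(2)[of 0 0] by simp_all
  have "f (\<Sum>c\<in>K. P c) = h (\<Sum>c\<in>K. P c)"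
    using assms(4,3)
  proof (induction K rule: finite_induct)
    case (insert c K)
    then show ?case by (simp add: assms(1,2))
  qed (simp add: 0)
  then show ?thesis unfolding assms(5) .
qed

text \<open>The coordinate map of the frame is onto a space of the same dimension, hence injective,
  so every vector equals its expansion.\<close>

lemma orthonormal_frame_parseval:
  fixes e :: "'n::finite \<Rightarrow> real^'n"
  assumes lin: "\<And>v. linear (\<lambda>u. b u v)" "\<And>u. linear (b u)" and sym: "\<And>u v. b u v = b v u"
    and e: "orthonormal_frame b e"
  shows "(\<Sum>i\<in>UNIV. b u (e i) * b v (e i)) = b u v"
proof -
  let ?\<phi> = "\<lambda>v. \<chi> i. b v (e i)"
  have phi: "linear ?\<phi>"
    by (rule linearI) (simp_all add: vec_eq_iff linear_add[OF lin(1)] linear_cmul[OF lin(1)])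
  have eij: "b (e i) (e j) = (if i = j then 1 else 0)" for i j
    using e by (simp add: orthonormal_frame_def)
  have comb: "?\<phi> (\<Sum>i\<in>UNIV. c i *\<^sub>R e i) = (\<chi> i. c i)" for c
    by (simp add: vec_eq_iff linear_sum[OF lin(1)] linear_cmul[OF lin(1)] eij if_distrib cong: if_cong)
  have "surj ?\<phi>"
  proof (rule surjI)
    show "?\<phi> (\<Sum>i\<in>UNIV. (y $ i) *\<^sub>R e i) = y" for y :: "real^'n"
      unfolding comb by simp
  qed
  then have inj: "inj ?\<phi>" by (rule linear_surjective_imp_injective[OF phi _ refl])
  have "?\<phi> (\<Sum>i\<in>UNIV. b v (e i) *\<^sub>R e i) = ?\<phi> v" by (rule comb)
  then have "(\<Sum>i\<in>UNIV. b v (e i) *\<^sub>R e i) = v" by (rule injD[OF inj])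
  then have "b u v = b u (\<Sum>i\<in>UNIV. b v (e i) *\<^sub>R e i)" by simp
  also have "\<dots> = (\<Sum>i\<in>UNIV. b v (e i) * b u (e i))"
    by (simp add: linear_sum[OF lin(2)] linear_cmul[OF lin(2)])
  finally show ?thesis by (simp add: mult.commute)
qed

section \<open>Powers of \<open>B0\<close> on eigenvectors\<close>

context constant_curvatures
begin

text \<open>A self-adjoint operator has no nonreal eigenvalue: for \<open>u + \<i> v\<close> in the
  kernel, \<open>S u = \<sigma> v\<close> and \<open>S v = - \<sigma> u\<close>, whence \<sigma>
  times the sum of the squared lengths is 0. Surjectivity follows from the real dimension.\<close>

lemma bij_shape_shift:
  assumes "\<sigma> \<noteq> 0"
  shows "bij (\<lambda>x. clinear_ext (S p) x + (of_real \<sigma> * \<i>) *s x)" (is "bij ?G")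
proof -
  have lin: "linear ?G"
    by (rule linearI)
      (simp_all add: scaleR_conv_vector_smult clinear_ext_add clinear_ext_scale vec_eq_iff algebra_simps)
  have "x = 0" if G: "?G x = 0" for x
  proof -
    obtain u v where x: "x = cvec u + \<i> *s cvec v" by (rule cvec_Re_Im)
    have "?G x = cvec (S p u - \<sigma> *\<^sub>R v) + \<i> *s cvec (S p v + \<sigma> *\<^sub>R u)"
      unfolding x clinear_ext_add clinear_ext_scale clinear_ext_cvec[OF linear_S]
      by (simp add: cvec_def vec_eq_iff algebra_simps)
    then have "S p u = \<sigma> *\<^sub>R v" "S p v = - (\<sigma> *\<^sub>R u)"
      using G by (simp_all add: cvec_combination_eq_0_iff eq_neg_iff_add_eq_0)
    then have "\<sigma> * (ip p v v + ip p u u) = 0"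
      using S_self_adjoint[of p u v] ip_linear(6)[of p u "- \<sigma>" u]
      by (simp add: ip_linear algebra_simps)
    then have *: "ip p v v + ip p u u = 0" using assms by simp
    have "ip p w w \<ge> 0" for w using ip_pos[of w p] by (cases "w = 0") (auto simp: ip_linear)
    from this[of u] this[of v] * have "ip p u u = 0" "ip p v v = 0" by linarith+
    then have "u = 0" "v = 0" using ip_pos[of u p] ip_pos[of v p] by (metis less_irrefl)+
    then show ?thesis by (simp add: x cvec_combination_eq_0_iff)
  qed
  then have "inj ?G" using linear_injective_0[OF lin] by blast
  moreover from linear_injective_imp_surjective[OF lin this refl] have "surj ?G" .
  ultimately show ?thesis by (simp add: bij_def)
qed

abbreviation "Bp \<equiv> B0_power \<A> F \<nu>"

text \<open>The class of functions of \<open>S\<close>: it is closed under inverses and composition,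
  so \<open>B0\<close> and its integer powers are read off from the multipliers
  \<open>m\<close>.\<close>

definition clinear_scaling_eigenvectors :: "'p \<Rightarrow> (complex^'n \<Rightarrow> complex^'n) \<Rightarrow> (real \<Rightarrow> complex) \<Rightarrow> bool" where
  "clinear_scaling_eigenvectors p f m \<longleftrightarrow> (\<forall>x y. f (x + y) = f x + f y) \<and> (\<forall>c x. f (c *s x) = c *s f x) \<and>
    (\<forall>a u. S p u = a *\<^sub>R u \<longrightarrow> f (cvec u) = m a *s cvec u)"

lemma clinear_scaling_inv:
  assumes f: "clinear_scaling_eigenvectors p f m" and "bij f" and nz: "\<And>a. m a \<noteq> 0"
  shows "clinear_scaling_eigenvectors p (inv f) (\<lambda>a. inverse (m a))"
proof -
  note i = inv_f_eq[OF bij_is_inj[OF \<open>bij f\<close>]]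
  note s = surj_f_inv_f[OF bij_is_surj[OF \<open>bij f\<close>]]
  show ?thesis
    unfolding clinear_scaling_eigenvectors_def
  proof (intro conjI allI impI)
    show "inv f (x + y) = inv f x + inv f y" for x y
      by (rule i) (use f in \<open>simp add: clinear_scaling_eigenvectors_def s\<close>)
    show "inv f (c *s x) = c *s inv f x" for c x
      by (rule i) (use f in \<open>simp add: clinear_scaling_eigenvectors_def s\<close>)
    show "inv f (cvec u) = inverse (m a) *s cvec u" if "S p u = a *\<^sub>R u" for a u
    proof (rule i)
      have "f (cvec u) = m a *s cvec u" using f that by (simp add: clinear_scaling_eigenvectors_def)
      then show "f (inverse (m a) *s cvec u) = cvec u"
        using f nz[of a] by (simp add: clinear_scaling_eigenvectors_def vector_smult_assoc)
    qed
  qed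
qed

lemma clinear_scaling_comp:
  assumes "clinear_scaling_eigenvectors p f m" "clinear_scaling_eigenvectors p h k"
  shows "clinear_scaling_eigenvectors p (f \<circ> h) (\<lambda>a. m a * k a)"
  unfolding clinear_scaling_eigenvectors_def
proof (intro conjI allI impI)
  fix a u assume "S p u = a *\<^sub>R u"
  then have "f (cvec u) = m a *s cvec u" "h (cvec u) = k a *s cvec u"
    using assms by (simp_all add: clinear_scaling_eigenvectors_def)
  then show "(f \<circ> h) (cvec u) = (m a * k a) *s cvec u"
    using assms by (simp add: clinear_scaling_eigenvectors_def vector_smult_assoc mult.commute)
qed (use assms in \<open>simp_all add: clinear_scaling_eigenvectors_def\<close>)

lemma clinear_scaling_funpow:
  assumes "clinear_scaling_eigenvectors p f m"
  shows "clinear_scaling_eigenvectors p (f ^^ n) (\<lambda>a. m a ^ n)"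
proof (induction n)
  case 0
  show ?case by (simp add: clinear_scaling_eigenvectors_def)
next
  case (Suc n)
  show ?case using clinear_scaling_comp[OF assms Suc] by (simp add: comp_def)
qed

lemma clinear_scaling_shift: "clinear_scaling_eigenvectors p (\<lambda>x. clinear_ext (S p) x + (of_real \<sigma> * \<i>) *s x)
    (\<lambda>a. of_real a + of_real \<sigma> * \<i>)"
  unfolding clinear_scaling_eigenvectors_def
proof (intro conjI allI impI)
  fix a u assume u: "S p u = a *\<^sub>R u"
  show "clinear_ext (S p) (cvec u) + (of_real \<sigma> * \<i>) *s cvec u = (of_real a + of_real \<sigma> * \<i>) *s cvec u"
    unfolding clinear_ext_cvec[OF linear_S] u cvec_scaleR by (simp add: vec_eq_iff algebra_simps)
qed (simp_all add: clinear_ext_add clinear_ext_scale vec_eq_iff algebra_simps)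

lemma B0_clinear_scaling: "bij (B0 \<A> F \<nu> p)" "clinear_scaling_eigenvectors p (B0 \<A> F \<nu> p) cayley"
proof -
  have m: "(\<lambda>x. clinear_ext (S p) x - \<i> *s x) = (\<lambda>x. clinear_ext (S p) x + (of_real (-1) * \<i>) *s x)"
    by (simp add: fun_eq_iff vec_eq_iff)
  have pl: "(\<lambda>x. clinear_ext (S p) x + \<i> *s x) = (\<lambda>x. clinear_ext (S p) x + (of_real 1 * \<i>) *s x)"
    by simp
  have bm: "bij (\<lambda>x. clinear_ext (S p) x - \<i> *s x)" unfolding m by (rule bij_shape_shift) simp
  have bp: "bij (\<lambda>x. clinear_ext (S p) x + \<i> *s x)" unfolding pl by (rule bij_shape_shift) simp
  show "bij (B0 \<A> F \<nu> p)"
    unfolding B0_def by (rule bij_comp[OF bij_imp_bij_inv[OF bm] bp])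
  have sm: "clinear_scaling_eigenvectors p (\<lambda>x. clinear_ext (S p) x - \<i> *s x) (\<lambda>a. of_real a - \<i>)"
    using clinear_scaling_shift[of p "-1"] unfolding m by simp
  have sp: "clinear_scaling_eigenvectors p (\<lambda>x. clinear_ext (S p) x + \<i> *s x) (\<lambda>a. of_real a + \<i>)"
    using clinear_scaling_shift[of p 1] by simp
  have "(\<lambda>a. (of_real a + \<i>) * inverse (of_real a - \<i>)) = cayley"
    by (rule ext) (simp only: cayley_def divide_inverse)
  with clinear_scaling_comp[OF sp clinear_scaling_inv[OF sm bm of_real_pm_i_nonzero(2)]]
  show "clinear_scaling_eigenvectors p (B0 \<A> F \<nu> p) cayley"
    unfolding B0_def by (simp only:)
qed

lemma B0_power_clinear_scaling: "clinear_scaling_eigenvectors p (Bp p k) (\<lambda>a. cayley a powi k)"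
proof (cases "k \<ge> 0")
  case True
  then show ?thesis
    using clinear_scaling_funpow[OF B0_clinear_scaling(2), of p "nat k"]
    by (simp add: B0_power_def power_int_def)
next
  case False
  then show ?thesis
    using clinear_scaling_funpow[OF clinear_scaling_inv[OF B0_clinear_scaling(2,1) cayley_nonzero], of p "nat (- k)"]
    by (simp add: B0_power_def power_int_def)
qed

lemma Bp_add: "Bp p k (x + y) = Bp p k x + Bp p k y"
  and Bp_eigen: "S p u = a *\<^sub>R u \<Longrightarrow> Bp p k (cvec u) = cayley a powi k *s cvec u"
  using B0_power_clinear_scaling[of p k] by (auto simp: clinear_scaling_eigenvectors_def)

lemma Bp_cvec: "Bp p k (cvec v) = (\<Sum>m\<in>K. cayley m powi k *s cvec (pr p m v))"
proof -
  have 0: "Bp p k 0 = 0" using Bp_add[of p k 0 0] by simp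
  have "Bp p k (\<Sum>m\<in>K. f m) = (\<Sum>m\<in>K. Bp p k (f m))" for f
    using K(1) by (induction K rule: finite_induct) (simp_all add: Bp_add 0)
  then have "Bp p k (cvec (\<Sum>m\<in>K. pr p m v)) = (\<Sum>m\<in>K. cayley m powi k *s cvec (pr p m v))"
    unfolding cvec_sum by (simp add: Bp_eigen[OF S_pr])
  then show ?thesis unfolding pr_sum .
qed

section \<open>Traces of products of \<alpha>\<close>

abbreviation "alp \<equiv> alpha \<A> F \<nu> D"

lemma alpha_cvec: "alp p (cvec u) (cvec v) (cvec w) = of_real (ip p (cov p u v) w)"
  unfolding alpha_def
  by (rule ctrilinear_ext_cvec) (simp_all add: linear_iff cov_add cov_scale cov_add_right cov_scale_right ip_linear)

lemmas alpha_add = ctrilinear_ext_add[of "\<lambda>u v w. ip p (cov p u v) w" for p, folded alpha_def]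
lemmas alpha_scale = ctrilinear_ext_scale[of "\<lambda>u v w. ip p (cov p u v) w" for p, folded alpha_def]
lemmas alpha_sum = ctrilinear_ext_sum[of "\<lambda>u v w. ip p (cov p u v) w" for p, folded alpha_def]

abbreviation "gh \<equiv> ghat \<A> F \<nu>"

lemma ghat_linear: "linear (\<lambda>u. gh p u v)" "linear (gh p u)"
  by (simp_all add: linear_iff ghat_def ip_linear S_add S_scale algebra_simps add_divide_distrib)

lemma ghat_commute: "gh p u v = gh p v u"
proof -
  have "gh p u v = (1/2) * (ip p u v + ip p (S p u) (S p v))" for u v
    by (simp add: ghat_def ip_linear S_self_adjoint)
  then show ?thesis by (simp only: ip_commute[of p u v] ip_commute[of p "S p u" "S p v"])
qed

lemma ghat_eigen: "S p v = a *\<^sub>R v \<Longrightarrow> gh p u v = (1 + a\<^sup>2) / 2 * ip p u v"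
  by (simp add: ghat_def ip_linear S_scale power2_eq_square algebra_simps)

text \<open>The first argument is the inverse of \<open>(1/2) (Id + S^2)\<close> applied to
  \<open>u\<close>, in spectral form.\<close>

lemma ghat_expansion: "gh p (\<Sum>m\<in>K. (2 / (1 + m\<^sup>2)) *\<^sub>R pr p m u) v = ip p u v"
proof -
  have pos: "1 + m\<^sup>2 \<noteq> 0" for m :: real by (metis add_pos_nonneg less_irrefl zero_le_power2 zero_less_one)
  have "gh p (\<Sum>m\<in>K. (2 / (1 + m\<^sup>2)) *\<^sub>R pr p m u) v = (\<Sum>m\<in>K. 2 / (1 + m\<^sup>2) * gh p v (pr p m u))"
    unfolding ghat_commute[of p _ v] by (simp add: linear_sum[OF ghat_linear(2)] linear_cmul[OF ghat_linear(2)])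
  also have "\<dots> = (\<Sum>m\<in>K. ip p (pr p m u) v)"
    by (rule sum.cong[OF refl], subst ghat_eigen[OF S_pr], subst ip_commute) (simp add: pos)
  also have "\<dots> = ip p u v" unfolding ip_sum_left[symmetric] pr_sum ..
  finally show ?thesis .
qed

text \<open>Both factors are \<open>ghat\<close>-products by \<open>ghat_expansion\<close>, so
  Parseval applies; this produces the weight \<open>2 / (1 + m^2)\<close>.\<close>

lemma frame_sum_pr:
  assumes e: "orthonormal_frame (gh p) e" and m: "m \<in> K"
  shows "(\<Sum>i\<in>UNIV. ip p u (e i) * ip p v (pr p m (e i))) = 2 / (1 + m\<^sup>2) * ip p u (pr p m v)"
proof -
  have K': "(\<Sum>k\<in>K. (2 / (1 + k\<^sup>2)) *\<^sub>R pr p k (pr p m v)) = (2 / (1 + m\<^sup>2)) *\<^sub>R pr p m v"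
  proof -
    have "(\<Sum>k\<in>K. (2 / (1 + k\<^sup>2)) *\<^sub>R pr p k (pr p m v)) =
        (\<Sum>k\<in>K. if k = m then (2 / (1 + m\<^sup>2)) *\<^sub>R pr p m v else 0)"
      by (rule sum.cong[OF refl]) (simp add: pr_eigen[OF S_pr])
    then show ?thesis using m K(1) by simp
  qed
  have "(\<Sum>i\<in>UNIV. ip p u (e i) * ip p v (pr p m (e i))) = (\<Sum>i\<in>UNIV. ip p u (e i) * ip p (pr p m v) (e i))"
    by (simp only: ip_pr(2)[of p m v])
  also have "\<dots> = gh p (\<Sum>k\<in>K. (2 / (1 + k\<^sup>2)) *\<^sub>R pr p k u) (\<Sum>k\<in>K. (2 / (1 + k\<^sup>2)) *\<^sub>R pr p k (pr p m v))"
    by (subst orthonormal_frame_parseval[OF ghat_linear ghat_commute e, symmetric])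
      (simp only: ghat_expansion)
  also have "\<dots> = 2 / (1 + m\<^sup>2) * ip p u (pr p m v)"
    unfolding ghat_expansion K' ip_linear(6) ..
  finally show ?thesis .
qed

text \<open>One of the four terms of the theorem; the others arise by permuting \<open>x\<close>,
  \<open>y\<close>, \<open>z\<close>, \<open>w\<close>, the last two after exchanging
  \<open>l\<close> and \<open>j\<close> as in \<open>trace_sum_swap\<close>.\<close>

definition trace_sum :: "'p \<Rightarrow> ('n \<Rightarrow> real^'n) \<Rightarrow> nat \<Rightarrow> real^'n \<Rightarrow> real^'n \<Rightarrow> real^'n \<Rightarrow> real^'n \<Rightarrow> complex" where
  "trace_sum p e g x y z w = (\<Sum>l<g. \<Sum>j<g. frame_trace e (\<lambda>u v.
    alp p (Bp p (- int l) (cvec y)) (Bp p (- int j) (cvec w)) u *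
      (\<Sum>k<j. alp p (Bp p (int l) (cvec x)) (Bp p (int k + 1) (cvec z)) (Bp p (int j - int k - 1) v)
            + alp p (Bp p (int l) (cvec x)) (Bp p (int k) (cvec z)) (Bp p (int j - int k) v))))"

lemma trace_sum_add:
  "trace_sum p e g (x + x') y z w = trace_sum p e g x y z w + trace_sum p e g x' y z w"
  "trace_sum p e g x (y + y') z w = trace_sum p e g x y z w + trace_sum p e g x y' z w"
  "trace_sum p e g x y (z + z') w = trace_sum p e g x y z w + trace_sum p e g x y z' w"
  "trace_sum p e g x y z (w + w') = trace_sum p e g x y z w + trace_sum p e g x y z w'"
  by (simp_all add: trace_sum_def frame_trace_def cvec_add Bp_add alpha_add sum.distrib algebra_simps)

lemma alpha_Bp_eigen:
  assumes x: "S p x = a *\<^sub>R x" and z: "S p z = c *\<^sub>R z"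
  shows "alp p (Bp p q (cvec x)) (Bp p r (cvec z)) (Bp p s (cvec v)) =
    cayley a powi q * (\<Sum>m\<in>K. cayley c powi r * cayley m powi s * of_real (ip p (cov p x z) (pr p m v)))"
  unfolding Bp_eigen[OF x] Bp_eigen[OF z]
  unfolding Bp_cvec alpha_sum alpha_scale alpha_cvec
  by (simp add: sum_distrib_left mult_ac)

lemma trace_sum_eigen:
  assumes e: "orthonormal_frame (gh p) e" and root: "\<And>a. a \<in> K \<Longrightarrow> cayley a ^ g = -1"
    and x: "S p x = a *\<^sub>R x" "a \<in> K" and y: "S p y = b *\<^sub>R y" "b \<in> K"
    and z: "S p z = c *\<^sub>R z" "c \<in> K" and w: "S p w = d *\<^sub>R w" "d \<in> K"
  shows "trace_sum p e g x y z w = (if a = b \<and> c = d then (of_nat g)\<^sup>2 * (- \<i> * of_real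
    (\<Sum>m\<in>K. (1 + c * m) / (m - c) * (2 / (1 + m\<^sup>2)) * ip p (cov p y w) (pr p m (cov p x z)))) else 0)"
proof -
  \<comment> \<open>With the traced slot split into eigenspaces, each summand factors into a trace
    \<open>\<tau> m\<close>, a factor \<open>R l\<close> and a factor depending on \<open>j\<close>
    and \<open>m\<close>, so the sums over \<open>l\<close> and \<open>j\<close> separate. The first
    gives \<open>g\<close> for \<open>a = b\<close>, the second \<open>g\<close> times the Cayley
    quotient for \<open>c = d\<close>.\<close>
  define \<tau> where "\<tau> m = 2 / (1 + m\<^sup>2) * ip p (cov p y w) (pr p m (cov p x z))" for m
  define C where "C j m = (\<Sum>k<j. cayley c powi (int k + 1) * cayley m powi (int j - int k - 1) +
      cayley c powi int k * cayley m powi (int j - int k))" for j m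
  define R where "R l = cayley b powi (- int l) * cayley a powi int l" for l
  have inner: "(\<Sum>k<j. alp p (Bp p (int l) (cvec x)) (Bp p (int k + 1) (cvec z)) (Bp p (int j - int k - 1) (cvec v))
        + alp p (Bp p (int l) (cvec x)) (Bp p (int k) (cvec z)) (Bp p (int j - int k) (cvec v))) =
      cayley a powi int l * (\<Sum>m\<in>K. C j m * of_real (ip p (cov p x z) (pr p m v)))" for l j v
  proof -
    have "(\<Sum>m\<in>K. C j m * of_real (ip p (cov p x z) (pr p m v))) =
      (\<Sum>k<j. \<Sum>m\<in>K. (cayley c powi (int k + 1) * cayley m powi (int j - int k - 1) +
        cayley c powi int k * cayley m powi (int j - int k)) * of_real (ip p (cov p x z) (pr p m v)))"
      unfolding C_def sum_distrib_right by (rule sum.swap)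
    then show ?thesis
      unfolding alpha_Bp_eigen[OF x(1) z(1)] distrib_left[symmetric] sum_distrib_left[symmetric]
        sum.distrib[symmetric] distrib_right[symmetric] by (simp only:)
  qed
  have outer: "alp p (Bp p (- int l) (cvec y)) (Bp p (- int j) (cvec w)) (cvec v) =
      cayley b powi (- int l) * (cayley d powi (- int j) * of_real (ip p (cov p y w) v))" for l j v
    unfolding Bp_eigen[OF y(1)] Bp_eigen[OF w(1)] alpha_scale alpha_cvec by (rule mult.left_commute)
  have trace: "frame_trace e (\<lambda>u v.
    alp p (Bp p (- int l) (cvec y)) (Bp p (- int j) (cvec w)) u *
      (\<Sum>k<j. alp p (Bp p (int l) (cvec x)) (Bp p (int k + 1) (cvec z)) (Bp p (int j - int k - 1) v)
            + alp p (Bp p (int l) (cvec x)) (Bp p (int k) (cvec z)) (Bp p (int j - int k) v))) =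
      (\<Sum>m\<in>K. of_real (\<tau> m) * (R l * (cayley d powi (- int j) * C j m)))" (is "?L = _") for l j
  proof -
    have arr: "s * (t * q) * (u * (\<Sum>m\<in>K. f m * h m)) = (\<Sum>m\<in>K. (q * h m) * (s * u * (t * f m)))"
      for s t q u :: complex and f h by (simp add: sum_distrib_left mult_ac)
    have "?L = (\<Sum>i\<in>UNIV. \<Sum>m\<in>K. (of_real (ip p (cov p y w) (e i)) * of_real (ip p (cov p x z) (pr p m (e i)))) *
        (cayley b powi (- int l) * cayley a powi int l * (cayley d powi (- int j) * C j m)))"
      unfolding frame_trace_def inner outer arr ..
    also have "\<dots> = (\<Sum>m\<in>K. \<Sum>i\<in>UNIV. (of_real (ip p (cov p y w) (e i)) * of_real (ip p (cov p x z) (pr p m (e i)))) *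
        (cayley b powi (- int l) * cayley a powi int l * (cayley d powi (- int j) * C j m)))"
      by (rule sum.swap)
    also have "\<dots> = (\<Sum>m\<in>K. of_real (\<tau> m) * (R l * (cayley d powi (- int j) * C j m)))"
      by (rule sum.cong[OF refl])
        (simp only: sum_distrib_right[symmetric] of_real_mult[symmetric] of_real_sum[symmetric]
          frame_sum_pr[OF e] \<tau>_def R_def)
    finally show ?thesis .
  qed
  have "trace_sum p e g x y z w = (\<Sum>l<g. \<Sum>j<g. \<Sum>m\<in>K. of_real (\<tau> m) * (R l * (cayley d powi (- int j) * C j m)))"
    unfolding trace_sum_def trace ..
  also have "\<dots> = (\<Sum>l<g. \<Sum>m\<in>K. \<Sum>j<g. of_real (\<tau> m) * (R l * (cayley d powi (- int j) * C j m)))"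
    by (rule sum.cong[OF refl]) (rule sum.swap)
  also have "\<dots> = (\<Sum>m\<in>K. \<Sum>l<g. \<Sum>j<g. of_real (\<tau> m) * (R l * (cayley d powi (- int j) * C j m)))"
    by (rule sum.swap)
  also have "\<dots> = (\<Sum>m\<in>K. of_real (\<tau> m) * ((\<Sum>l<g. R l) * (\<Sum>j<g. cayley d powi (- int j) * C j m)))"
    by (simp only: sum_distrib_left[symmetric] sum_distrib_right[symmetric])
  also have "(\<Sum>l<g. R l) = (if a = b then of_nat g else 0)"
  proof -
    have "R l = (cayley a / cayley b) ^ l" for l
      by (simp add: R_def power_int_minus power_divide divide_inverse mult.commute power_inverse power_mult_distrib)
    moreover have "(cayley a / cayley b) ^ g = 1" using root[OF x(2)] root[OF y(2)] by (simp add: power_divide)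
    ultimately show ?thesis
      using sum_root_of_unity_powers[of "cayley a / cayley b" g] by (simp add: cayley_nonzero cayley_eq_iff)
  qed
  also have "(\<Sum>m\<in>K. of_real (\<tau> m) * ((if a = b then of_nat g else 0) * (\<Sum>j<g. cayley d powi (- int j) * C j m))) =
    (\<Sum>m\<in>K. (if a = b \<and> c = d then (of_nat g)\<^sup>2 else 0) * (- \<i> * of_real ((1 + c * m) / (m - c) * \<tau> m)))"
  proof (rule sum.cong[OF refl])
    fix m assume m: "m \<in> K"
    \<comment> \<open>\<open>double_geometric_sum\<close> excludes \<open>m = c\<close> and
      \<open>m = d\<close>, but there \<open>\<tau> m\<close> is zero because \<alpha> has two
      arguments in one eigenspace.\<close>
    consider "m = c" | "m = d" | "c \<noteq> m" "d \<noteq> m" by blast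
    then show "of_real (\<tau> m) * ((if a = b then of_nat g else 0) * (\<Sum>j<g. cayley d powi (- int j) * C j m)) =
      (if a = b \<and> c = d then (of_nat g)\<^sup>2 else 0) * (- \<i> * of_real ((1 + c * m) / (m - c) * \<tau> m))"
    proof cases
      case 1
      then have "\<tau> m = 0" by (simp add: \<tau>_def pr_cov_eigen(1)[OF z(1)] ip_linear)
      then show ?thesis by simp
    next
      case 2
      then have "\<tau> m = 0"
        by (simp add: \<tau>_def ip_pr(2)[symmetric] pr_cov_eigen(1)[OF w(1)] ip_linear)
      then show ?thesis by simp
    next
      case 3
      show ?thesis
        unfolding C_def double_geometric_sum[OF root[OF z(2)] root[OF w(2)] root[OF m] 3]
        by (simp add: power2_eq_square)
    qed
  qed
  also have "\<dots> = (if a = b \<and> c = d then (of_nat g)\<^sup>2 else 0) * (- \<i> * of_real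
      (\<Sum>m\<in>K. (1 + c * m) / (m - c) * \<tau> m))"
    by (simp only: sum_distrib_left[symmetric] of_real_sum[symmetric])
  finally have sum: "trace_sum p e g x y z w = (if a = b \<and> c = d then (of_nat g)\<^sup>2 else 0) * (- \<i> * of_real
      (\<Sum>m\<in>K. (1 + c * m) / (m - c) * \<tau> m))" .
  have "(\<Sum>m\<in>K. (1 + c * m) / (m - c) * \<tau> m) =
      (\<Sum>m\<in>K. (1 + c * m) / (m - c) * (2 / (1 + m\<^sup>2)) * ip p (cov p y w) (pr p m (cov p x z)))"
    by (simp only: \<tau>_def mult.assoc)
  then show ?thesis
    unfolding sum by (cases "a = b \<and> c = d") (simp_all only: if_True if_False mult_zero_left simp_thms)
qed

section \<open>The tensor \<open>T\<close> and the comparison of both sides\<close>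

abbreviation "Tt \<equiv> T_tensor \<A> F \<nu>"

lemma T_tensor_add:
  "Tt p (x + x') y z w = Tt p x y z w + Tt p x' y z w"
  "Tt p x (y + y') z w = Tt p x y z w + Tt p x y' z w"
  "Tt p x y (z + z') w = Tt p x y z w + Tt p x y z' w"
  "Tt p x y z (w + w') = Tt p x y z w + Tt p x y z w'"
  by (simp_all only: T_tensor_def cvec_add Bp_add cbilinear_ext_add distrib_left distrib_right plus_complex.sel)

text \<open>The weights \<open>(1 + a^2) / 2\<close> and \<open>(1 + c^2) / 2\<close> of
  \<open>ghat\<close> clear the denominators in \<open>Im_cayley_quotient\<close>; for different
  eigenspaces orthogonality gives 0.\<close>

lemma T_tensor_eigen:
  assumes x: "S p x = a *\<^sub>R x" and y: "S p y = b *\<^sub>R y" and z: "S p z = c *\<^sub>R z" and w: "S p w = d *\<^sub>R w"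
  shows "Tt p x y z w = (if a = b \<and> c = d then (c - a) / 2 * ((1 + a * c) * ip p x y * ip p z w) else 0)"
proof -
  have 1: "cbilinear_ext (gh p) (Bp p k (cvec u)) (cvec v) = cayley t powi k * of_real (gh p u v)"
    if "S p u = t *\<^sub>R u" for k t u v
    unfolding Bp_eigen[OF that] cbilinear_ext_scale cbilinear_ext_cvec[OF ghat_linear] ..
  have "Tt p x y z w = Im (cayley a * inverse (cayley c) * of_real (gh p x y * gh p z w))"
    unfolding T_tensor_def 1[OF x] 1[OF z] by (simp add: power_int_minus mult_ac)
  also have "\<dots> = Im (cayley a * inverse (cayley c)) * (gh p x y * gh p z w)"
    by (simp only: times_complex.sel Re_complex_of_real Im_complex_of_real)
  also have "gh p x y = (1 + b\<^sup>2) / 2 * ip p x y" by (rule ghat_eigen[OF y])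
  also have "gh p z w = (1 + d\<^sup>2) / 2 * ip p z w" by (rule ghat_eigen[OF w])
  finally have T: "Tt p x y z w = Im (cayley a * inverse (cayley c)) * ((1 + b\<^sup>2) * (1 + d\<^sup>2)) / 4 * (ip p x y * ip p z w)"
    by simp
  show ?thesis
  proof (cases "a = b \<and> c = d")
    case True
    then have T': "Tt p x y z w = 2 * (1 + a * c) * (c - a) / 4 * (ip p x y * ip p z w)"
      using T Im_cayley_quotient[of a c] by simp
    have "2 * s * t / 4 * (q * r) = t / 2 * (s * q * r)" for q r s t :: real by simp
    then show ?thesis unfolding T' using True by (simp only: if_True simp_thms)
  next
    case False
    then have "ip p x y = 0 \<or> ip p z w = 0"
      using eigen_orthogonal[OF x y] eigen_orthogonal[OF z w] by auto
    then show ?thesis using T False by auto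
  qed
qed

text \<open>The source of Cartan's weight: the numerator of the difference contains
  \<open>1 + m^2\<close>, the reciprocal of the trace weight up to the factor 2.\<close>

lemma curvature_coefficient:
  fixes a c m :: real
  assumes "m \<noteq> a" "m \<noteq> c"
  shows "(1 + c * m) / (m - c) * (2 / (1 + m\<^sup>2)) - (1 + a * m) / (m - a) * (2 / (1 + m\<^sup>2)) =
    2 * (c - a) / ((m - a) * (m - c))"
proof -
  have pos: "1 + m\<^sup>2 \<noteq> 0" by (metis add_pos_nonneg less_irrefl zero_le_power2 zero_less_one)
  have "(1 + c * m) / (m - c) - (1 + a * m) / (m - a) = (c - a) * (1 + m\<^sup>2) / ((m - a) * (m - c))"
    using assms by (simp add: diff_frac_eq power2_eq_square) (simp add: algebra_simps)
  then show ?thesis unfolding left_diff_distrib[symmetric] using pos by simp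
qed

lemma T_tensor_identity_eigen:
  assumes e: "orthonormal_frame (gh p) e" and root: "\<And>a. a \<in> K \<Longrightarrow> cayley a ^ g = -1"
    and x: "S p x = a *\<^sub>R x" "a \<in> K" and y: "S p y = b *\<^sub>R y" "b \<in> K"
    and z: "S p z = c *\<^sub>R z" "c \<in> K" and w: "S p w = d *\<^sub>R w" "d \<in> K"
  shows "- 4 * \<i> * (of_nat g)\<^sup>2 * complex_of_real (Tt p x y z w) =
    trace_sum p e g x y z w + trace_sum p e g x y w z - trace_sum p e g z w x y - trace_sum p e g z w y x"
proof (cases "a = b \<and> c = d")
  case False
  then have F: "\<not> (a = b \<and> d = c)" "\<not> (c = d \<and> a = b)" "\<not> (c = d \<and> b = a)" by blast+
  show ?thesis
    by (simp only: T_tensor_eigen[OF x(1) y(1) z(1) w(1)] trace_sum_eigen[OF e root x y z w] trace_sum_eigen[OF e root x y w z]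
        trace_sum_eigen[OF e root z w x y] trace_sum_eigen[OF e root z w y x] False F if_False) simp
next
  case True
  define \<beta> where "\<beta> t m = (1 + t * m) / (m - t) * (2 / (1 + m\<^sup>2))" for t m :: real
  define h1 where "h1 m = ip p (pr p m (cov p y w)) (cov p x z)" for m
  define h2 where "h2 m = ip p (pr p m (cov p y z)) (cov p x w)" for m
  have ya: "S p y = a *\<^sub>R y" and wc: "S p w = c *\<^sub>R w" using True y(1) w(1) by auto
  have sw: "ip p u (pr p m v) = ip p (pr p m u) v" for u v m by (simp add: ip_pr(2))
  have sw': "ip p u (pr p m v) = ip p (pr p m v) u" for u v m by (rule ip_commute)
  have T1: "trace_sum p e g x y z w = (of_nat g)\<^sup>2 * (- \<i> * of_real (\<Sum>m\<in>K. \<beta> c m * h1 m))"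
    using True by (simp add: trace_sum_eigen[OF e root x y z w] \<beta>_def h1_def sw)
  have T2: "trace_sum p e g x y w z = (of_nat g)\<^sup>2 * (- \<i> * of_real (\<Sum>m\<in>K. \<beta> c m * h2 m))"
    using True by (simp add: trace_sum_eigen[OF e root x y w z] \<beta>_def h2_def sw)
  \<comment> \<open>Exchanging the pairs replaces \<beta> at \<open>c\<close> by \<beta> at
    \<open>a\<close>, while symmetry of \<open>cov\<close> brings back the same products
    \<open>h1\<close> and \<open>h2\<close>.\<close>
  have T3: "trace_sum p e g z w x y = (of_nat g)\<^sup>2 * (- \<i> * of_real (\<Sum>m\<in>K. \<beta> a m * h1 m))"
    using True by (simp add: trace_sum_eigen[OF e root z w x y] \<beta>_def h1_def sw cov_commute[of p w y] cov_commute[of p z x])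
  have T4: "trace_sum p e g z w y x = (of_nat g)\<^sup>2 * (- \<i> * of_real (\<Sum>m\<in>K. \<beta> a m * h2 m))"
    using True by (simp add: trace_sum_eigen[OF e root z w y x] \<beta>_def h2_def sw' cov_commute[of p w x] cov_commute[of p z y])
  have "(\<Sum>m\<in>K. \<beta> c m * h1 m) + (\<Sum>m\<in>K. \<beta> c m * h2 m) - (\<Sum>m\<in>K. \<beta> a m * h1 m) - (\<Sum>m\<in>K. \<beta> a m * h2 m) =
      (\<Sum>m\<in>K. (\<beta> c m - \<beta> a m) * (h1 m + h2 m))"
    unfolding sum.distrib[symmetric] sum_subtractf[symmetric]
    by (rule sum.cong[OF refl]) (simp add: algebra_simps)
  \<comment> \<open>For \<open>a = c\<close> both sides vanish; Cartan's identity is called upon for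
    distinct curvatures only.\<close>
  also have "\<dots> = 2 * (c - a) * ((1 + a * c) * ip p x y * ip p z w)"
  proof (cases "a = c")
    case False
    have "(\<beta> c m - \<beta> a m) * (h1 m + h2 m) = 2 * (c - a) * ((h1 m + h2 m) / ((m - a) * (m - c)))" for m
    proof -
      consider "m = a" | "m = c" | "m \<noteq> a" "m \<noteq> c" by blast
      then show ?thesis
      proof cases
        case 1
        then have "h1 m = 0" "h2 m = 0"
          by (simp_all add: h1_def h2_def pr_cov_eigen(2)[OF ya] ip_linear)
        then show ?thesis by simp
      next
        case 2
        then have "h1 m = 0" "h2 m = 0"
          by (simp_all add: h1_def h2_def pr_cov_eigen(1)[OF wc] pr_cov_eigen(1)[OF z(1)] ip_linear)
        then show ?thesis by simp
      next
        case 3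
        show ?thesis unfolding \<beta>_def curvature_coefficient[OF 3] by simp
      qed
    qed
    then have "(\<Sum>m\<in>K. (\<beta> c m - \<beta> a m) * (h1 m + h2 m)) =
        2 * (c - a) * (\<Sum>m\<in>K. (h1 m + h2 m) / ((m - a) * (m - c)))"
      by (simp only: sum_distrib_left)
    then show ?thesis
      using cartan_polarised[OF x(1) ya z(1) wc False] by (simp only: h1_def h2_def)
  qed simp
  finally have s: "(\<Sum>m\<in>K. \<beta> c m * h1 m) + (\<Sum>m\<in>K. \<beta> c m * h2 m) - (\<Sum>m\<in>K. \<beta> a m * h1 m) - (\<Sum>m\<in>K. \<beta> a m * h2 m) =
    2 * (c - a) * ((1 + a * c) * ip p x y * ip p z w)" .
  have collect: "q * (- \<i> * of_real s1) + q * (- \<i> * of_real s2) - q * (- \<i> * of_real s3) - q * (- \<i> * of_real s4) =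
      q * (- \<i> * of_real (s1 + s2 - s3 - s4))" for q s1 s2 s3 s4
    by (simp add: algebra_simps)
  have T: "Tt p x y z w = (c - a) / 2 * ((1 + a * c) * ip p x y * ip p z w)"
    using True by (simp add: T_tensor_eigen[OF x(1) y(1) z(1) w(1)])
  show ?thesis
    unfolding T1 T2 T3 T4 collect s T by simp
qed

lemma T_tensor_identity:
  assumes e: "orthonormal_frame (gh p) e" and root: "\<And>a. a \<in> K \<Longrightarrow> cayley a ^ g = -1"
  shows "- 4 * \<i> * (of_nat g)\<^sup>2 * complex_of_real (Tt p x y z w) =
    trace_sum p e g x y z w + trace_sum p e g x y w z - trace_sum p e g z w x y - trace_sum p e g z w y x"
proof -
  define L where "L x y z w = - 4 * \<i> * (of_nat g)\<^sup>2 * complex_of_real (Tt p x y z w)" for x y z w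
  define R where "R x y z w = trace_sum p e g x y z w + trace_sum p e g x y w z - trace_sum p e g z w x y - trace_sum p e g z w y x" for x y z w
  have L: "L (x + x') y z w = L x y z w + L x' y z w" "L x (y + y') z w = L x y z w + L x y' z w"
    "L x y (z + z') w = L x y z w + L x y z' w" "L x y z (w + w') = L x y z w + L x y z w'"
    for x x' y y' z z' w w'
    unfolding L_def T_tensor_add by (simp_all only: of_real_add distrib_left)
  have R: "R (x + x') y z w = R x y z w + R x' y z w" "R x (y + y') z w = R x y z w + R x y' z w"
    "R x y (z + z') w = R x y z w + R x y z' w" "R x y z (w + w') = R x y z w + R x y z w'"
    for x x' y y' z z' w w'
    unfolding R_def trace_sum_add by simp_all
  note ind = additive_eigen_induct[OF _ _ _ K(1) pr_sum[symmetric, where q = p]]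
  \<comment> \<open>Facts \<open>0\<close> to \<open>3\<close> free the slots from eigenvectors one
    at a time, beginning with the last.\<close>
  have 0: "L (pr p a x) (pr p b y) (pr p c z) (pr p d w) = R (pr p a x) (pr p b y) (pr p c z) (pr p d w)"
    if "a \<in> K" "b \<in> K" "c \<in> K" "d \<in> K" for a b c d
    unfolding L_def R_def by (rule T_tensor_identity_eigen[OF e root S_pr that(1) S_pr that(2) S_pr that(3) S_pr that(4)])
  have 1: "L (pr p a x) (pr p b y) (pr p c z) w = R (pr p a x) (pr p b y) (pr p c z) w"
    if "a \<in> K" "b \<in> K" "c \<in> K" for a b c
    by (rule ind[of "\<lambda>w. L (pr p a x) (pr p b y) (pr p c z) w" "\<lambda>w. R (pr p a x) (pr p b y) (pr p c z) w",
          OF L(4) R(4)]) (rule 0[OF that])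
  have 2: "L (pr p a x) (pr p b y) z w = R (pr p a x) (pr p b y) z w"
    if "a \<in> K" "b \<in> K" for a b
    by (rule ind[of "\<lambda>z. L (pr p a x) (pr p b y) z w" "\<lambda>z. R (pr p a x) (pr p b y) z w", OF L(3) R(3)])
      (rule 1[OF that])
  have 3: "L (pr p a x) y z w = R (pr p a x) y z w" if "a \<in> K" for a
    by (rule ind[of "\<lambda>y. L (pr p a x) y z w" "\<lambda>y. R (pr p a x) y z w", OF L(2) R(2)])
      (rule 2[OF that])
  have "L x y z w = R x y z w"
    by (rule ind[of "\<lambda>x. L x y z w" "\<lambda>x. R x y z w", OF L(1) R(1)]) (rule 3)
  then show ?thesis unfolding L_def R_def .
qed

lemma trace_sum_swap:
  "trace_sum p e g x y z w = (\<Sum>l<g. \<Sum>j<g. frame_trace e (\<lambda>u v.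
    alp p (Bp p (- int j) (cvec y)) (Bp p (- int l) (cvec w)) u *
      (\<Sum>k<l. alp p (Bp p (int j) (cvec x)) (Bp p (int k + 1) (cvec z)) (Bp p (int l - int k - 1) v)
            + alp p (Bp p (int j) (cvec x)) (Bp p (int k) (cvec z)) (Bp p (int l - int k) v))))"
  unfolding trace_sum_def by (rule sum.swap)

end

theorem theorem3p8:
  fixes \<A> :: "('p::{t2_space,second_countable_topology}, 'n::finite) chart set"
    and F \<nu> :: "'p \<Rightarrow> real^'m"
    and D :: "('p \<Rightarrow> real^'n) \<Rightarrow> ('p \<Rightarrow> real^'n) \<Rightarrow> ('p \<Rightarrow> real^'n)"
    and g :: nat
    and \<kappa> :: "nat \<Rightarrow> real"
    and X Y Z W :: "'p \<Rightarrow> real^'n"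
    and p :: 'p
    and e :: "'n \<Rightarrow> real^'n"
  assumes "smooth_atlas \<A>"
    and "connected (UNIV :: 'p set)"
    and "isoparametric \<A> F \<nu> g \<kappa>"
    and "\<forall>j\<in>{1..g}. \<kappa> j = cot ((2 * real j - 1) * (pi / (2 * real g)))"
    and "levi_civita \<A> (induced_metric \<A> F) D"
    and "smooth_field \<A> X" and "smooth_field \<A> Y" and "smooth_field \<A> Z" and "smooth_field \<A> W"
    and "orthonormal_frame (ghat \<A> F \<nu> p) e"
  shows
    "let \<alpha> = alpha \<A> F \<nu> D p; B = B0_power \<A> F \<nu> p; tr = frame_trace e;
         x = cvec (X p); y = cvec (Y p); z = cvec (Z p); w = cvec (W p)
     in - 4 * \<i> * (of_nat g)\<^sup>2 * complex_of_real (T_tensor \<A> F \<nu> p (X p) (Y p) (Z p) (W p)) =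
       (\<Sum>l<g. \<Sum>j<g. tr (\<lambda>u v.
           \<alpha> (B (- int l) y) (B (- int j) w) u *
             (\<Sum>k<j. \<alpha> (B (int l) x) (B (int k + 1) z) (B (int j - int k - 1) v)
                   + \<alpha> (B (int l) x) (B (int k) z) (B (int j - int k) v))
         + \<alpha> (B (- int l) y) (B (- int j) z) u *
             (\<Sum>k<j. \<alpha> (B (int l) x) (B (int k + 1) w) (B (int j - int k - 1) v)
                   + \<alpha> (B (int l) x) (B (int k) w) (B (int j - int k) v))
         - \<alpha> (B (- int j) w) (B (- int l) y) u *
             (\<Sum>k<l. \<alpha> (B (int j) z) (B (int k + 1) x) (B (int l - int k - 1) v)
                   + \<alpha> (B (int j) z) (B (int k) x) (B (int l - int k) v))
         - \<alpha> (B (- int j) w) (B (- int l) x) u *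
             (\<Sum>k<l. \<alpha> (B (int j) z) (B (int k + 1) y) (B (int l - int k - 1) v)
                   + \<alpha> (B (int j) z) (B (int k) y) (B (int l - int k) v))))"
proof -
  have sh: "sphere_hypersurface \<A> F \<nu>"
    and K: "\<And>q. {c. \<exists>u. u \<noteq> 0 \<and> shape_operator \<A> F \<nu> q u = c *\<^sub>R u} = \<kappa> ` {1..g}"
    using assms(3) unfolding isoparametric_def by blast+
  interpret constant_curvatures \<A> F \<nu> D "\<kappa> ` {1..g}"
    by unfold_locales (use assms(1,5) sh K in auto)
  have root: "cayley a ^ g = -1" if a: "a \<in> \<kappa> ` {1..g}" for a
  proof -
    obtain j where j: "j \<in> {1..g}" "a = \<kappa> j" using a by blast
    then have "g > 0" by auto
    from cayley_cot_power[OF this j(1)] show ?thesis using assms(4) j by simp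
  qed
  have split: "(\<Sum>l<g. \<Sum>j<g. frame_trace e (\<lambda>u v. P l j u v + Q l j u v - R l j u v - T l j u v)) =
      (\<Sum>l<g. \<Sum>j<g. frame_trace e (P l j)) + (\<Sum>l<g. \<Sum>j<g. frame_trace e (Q l j)) -
      (\<Sum>l<g. \<Sum>j<g. frame_trace e (R l j)) - (\<Sum>l<g. \<Sum>j<g. frame_trace e (T l j))" for P Q R T
    by (simp add: frame_trace_def sum.distrib sum_subtractf)
  from T_tensor_identity[OF assms(10) root, of "X p" "Y p" "Z p" "W p"]
  show ?thesis
    unfolding Let_def split trace_sum_swap[of p e g "Z p" "W p"] unfolding trace_sum_def .
qed

end
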